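(* Let $\alpha \in \mathcal{A}$, $\rho \in [1-1/\alpha,\,1/\alpha] \cap (0,1)$ and $0<\beta<1$. Then $$ g(\beta) = \sum_{m=1}^\infty \frac{(-1)^{m+1} \beta^{m}\sin(\rho m \pi)}{m\sin\left(\frac{m\pi}{\alpha}\right)} + \sum_{k=1}^\infty \frac{(-1)^{k+1} \beta^{\alpha k}\sin(\rho\alpha k\pi)}{k\sin(\alpha k\pi)}\,. $$
   Context: A real number $x$ is a Liouville number if for every positive integer $n$ there exist infinitely many pairs of integers $p,q$ (with $q\ge 1$) such that $0<|x-p/q|<1/q^n$. Let $\mathcal{L}$ be the set of all Liouville numbers and $\mathcal{A} = (0,2]\setminus(\mathbb{Q}\cup\mathcal{L})$. For given $\alpha$ and $\rho$, the function $g$ is defined for $\beta>0$ by $$ g(\beta) = \frac{\sin(\pi \rho)}{\pi}\int_0^\infty \frac{\beta \log(1 + x^\alpha)}{x^2+2x\beta\cos(\pi\rho)+\beta^2}\,dx . $$ *)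

theory Defs
  imports "HOL-Analysis.Analysis"
begin

definition liouville_numbers :: "real set" where
  "liouville_numbers = {x. \<forall>n::nat. n \<ge> 1 \<longrightarrow>
     infinite {(p::int, q::int). q \<ge> 1 \<and>
       0 < \<bar>x - of_int p / of_int q\<bar> \<and> \<bar>x - of_int p / of_int q\<bar> < 1 / of_int q ^ n}}"

definition admissible_indices :: "real set" where
  "admissible_indices = {0<..2} - (\<rat> \<union> liouville_numbers)"

definition g :: "real \<Rightarrow> real \<Rightarrow> real \<Rightarrow> real" where
  "g \<alpha> \<rho> \<beta> = sin (pi * \<rho>) / pi *
     (LBINT x:{0<..}. \<beta> * ln (1 + x powr \<alpha>) / (x^2 + 2 * x * \<beta> * cos (pi * \<rho>) + \<beta>^2))"

end

theory Submission
  imports Defs "HOL-Complex_Analysis.Conformal_Mappings" "HOL-Real_Asymp.Real_Asymp"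
begin

text \<open>
  Write \<open>\<theta> = \<pi>\<rho>\<close> and let \<open>P(x) = \<beta> sin \<theta> / (x\<^sup>2 + 2x\<beta> cos \<theta> + \<beta>\<^sup>2)\<close>, so that \<open>\<pi> g(\<beta>)\<close> is the integral
  of \<open>ln (1 + x\<^sup>\<alpha>) P(x)\<close> over the positive half-line. The integral is split at \<open>x = 1\<close>, where the
  logarithm changes its expansion.

  On \<open>(0,1)\<close> the logarithm is expanded in powers of \<open>x\<^sup>\<alpha>\<close>, and each term is a moment
  \<open>\<integral>\<^sub>0\<^sup>1 x\<^sup>a P(x) dx\<close> with \<open>a = \<alpha>k\<close> not an integer. Since \<open>P(x) = - Im (1 / (x + w))\<close> for \<open>w = \<beta> e\<^sup>i\<^sup>\<theta>\<close>, such a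
  moment comes from the Stieltjes transform
  \<open>\<integral>\<^sub>0\<^sup>1 x\<^sup>a / (x + w) dx = (\<Sum>m. (-w)\<^sup>m / (a - m)) - \<pi> w\<^sup>a / sin (\<pi>a)\<close>
  (\<open>stieltjes_powr_integral\<close>). For \<open>0 < w < 1\<close> this is a computation with truncated geometric
  series on the two sides of \<open>x = w\<close>, in which the boundary terms at \<open>x = w\<close> add up to the partial
  fraction series of the cosecant; the identity theorem carries it to complex \<open>w\<close>. The power \<open>w\<^sup>a\<close>
  produces the series in \<open>\<beta>\<^bsup>\<alpha>k\<^esup>\<close> of the theorem exactly, and a double series with
  denominators \<open>\<alpha>k - m\<close> remains.

  On \<open>(1,\<infinity>)\<close> the kernel is expanded in powers of \<open>\<beta>/x\<close>, which gives a multiple of \<open>\<beta>\<^sup>m\<close> in each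
  term, with factor \<open>\<alpha>/m\<^sup>2\<close> plus a series over \<open>k\<close> with denominators \<open>k(\<alpha>k + m)\<close>.

  Because \<open>\<alpha>\<close> is irrational and not a Liouville number, \<open>1 / (k \<bar>\<alpha>k - m\<bar>)\<close> is at most a power of \<open>m\<close>
  times \<open>1/k\<^sup>2\<close> (\<open>small_divisor_bound\<close>). The factor \<open>\<beta>\<^sup>m\<close> absorbs the power of \<open>m\<close>, so the double
  series may be summed over \<open>k\<close> first. There it meets the terms with \<open>\<alpha>k + m\<close>, and the cosecant
  expansion at \<open>m/\<alpha>\<close> (\<open>pi_csc_partial_fractions_scaled\<close>) turns their sum into
  \<open>\<pi> / (m sin (\<pi>m/\<alpha>))\<close>: the coefficient of the series in \<open>\<beta>\<^sup>m\<close>. Both series of the theorem converge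
  because, up to a factor \<open>\<pi>\<close>, their terms are differences and sums of terms of convergent series.
\<close>

section \<open>Interchange of limits\<close>

text \<open>
  Fubini for ordered double series. The convergence of the rows, the columns and both iterated series
  is part of the conclusion because the two series of the main result inherit their convergence
  from it.
\<close>
lemma dominated_double_series_swap:
  fixes A :: "nat \<Rightarrow> nat \<Rightarrow> real"
  assumes bound: "\<And>k m. \<bar>A k m\<bar> \<le> u k * v m"
    and u: "summable u" and v: "summable v"
  shows "summable (\<lambda>m. A k m)" "summable (\<lambda>k. A k m)"
    and "summable (\<lambda>k. \<Sum>m. A k m)" "summable (\<lambda>m. \<Sum>k. A k m)"
    and "(\<Sum>k. \<Sum>m. A k m) = (\<Sum>m. \<Sum>k. A k m)"
proof -
  have row: "summable (\<lambda>m. \<bar>A k m\<bar>)" for k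
    by (rule summable_comparison_test'[OF summable_mult[OF v, of "u k"]]) (use bound in auto)
  have col: "summable (\<lambda>k. \<bar>A k m\<bar>)" for m
    by (rule summable_comparison_test'[OF summable_mult2[OF u, of "v m"]]) (use bound in auto)
  show r: "summable (\<lambda>m. A k m)" and c: "summable (\<lambda>k. A k m)" for k m
    by (rule summable_rabs_cancel[OF row], rule summable_rabs_cancel[OF col])
  have 1: "\<bar>\<Sum>m. A k m\<bar> \<le> u k * suminf v" for k
  proof -
    have "\<bar>\<Sum>m. A k m\<bar> \<le> (\<Sum>m. \<bar>A k m\<bar>)" by (rule summable_rabs[OF row])
    also have "\<dots> \<le> (\<Sum>m. u k * v m)" by (intro suminf_le bound row summable_mult v)
    finally show ?thesis using v by (simp add: suminf_mult)
  qed
  have 2: "\<bar>\<Sum>k. A k m\<bar> \<le> suminf u * v m" for m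
  proof -
    have "\<bar>\<Sum>k. A k m\<bar> \<le> (\<Sum>k. \<bar>A k m\<bar>)" by (rule summable_rabs[OF col])
    also have "\<dots> \<le> (\<Sum>k. u k * v m)" by (intro suminf_le bound col summable_mult2 u)
    finally show ?thesis using u by (simp add: suminf_mult2)
  qed
  show s1: "summable (\<lambda>k. \<Sum>m. A k m)"
    by (rule summable_comparison_test'[OF summable_mult2[OF u, of "suminf v"]]) (use 1 in auto)
  show s2: "summable (\<lambda>m. \<Sum>k. A k m)"
    by (rule summable_comparison_test'[OF summable_mult[OF v, of "suminf u"]]) (use 2 in auto)
  \<comment> \<open>A finite outer sum may be interchanged; what is left is dominated by a tail of \<open>u\<close>, which tends to \<open>0\<close>.\<close>
  have "(\<lambda>K. \<Sum>m. \<Sum>k. A (k + K) m) \<longlonglongrightarrow> 0"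
  proof (rule Lim_null_comparison)
    have sv: "summable (\<lambda>m. (\<Sum>k. u (k + K)) * v m)" for K by (intro summable_mult v)
    have b: "\<bar>\<Sum>k. A (k + K) m\<bar> \<le> (\<Sum>k. u (k + K)) * v m" for K m
    proof -
      have a: "summable (\<lambda>k. \<bar>A (k + K) m\<bar>)"
        using col[of m] by (subst summable_iff_shift)
      have "summable (\<lambda>k. u (k + K))" using u by (subst summable_iff_shift)
      moreover have "\<bar>\<Sum>k. A (k + K) m\<bar> \<le> (\<Sum>k. \<bar>A (k + K) m\<bar>)" by (rule summable_rabs[OF a])
      moreover have "\<dots> \<le> (\<Sum>k. u (k + K) * v m)"
        using calculation by (intro suminf_le bound a summable_mult2)
      ultimately show ?thesis by (simp add: suminf_mult2)
    qed
    show "\<forall>\<^sub>F K in sequentially. norm (\<Sum>m. \<Sum>k. A (k + K) m) \<le> (\<Sum>k. u (k + K)) * suminf v"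
    proof (intro always_eventually allI)
      fix K
      have s: "summable (\<lambda>m. \<bar>\<Sum>k. A (k + K) m\<bar>)"
        by (rule summable_comparison_test'[OF sv[of K]]) (use b in auto)
      have "\<bar>\<Sum>m. \<Sum>k. A (k + K) m\<bar> \<le> (\<Sum>m. \<bar>\<Sum>k. A (k + K) m\<bar>)" by (rule summable_rabs[OF s])
      also have "\<dots> \<le> (\<Sum>m. (\<Sum>k. u (k + K)) * v m)" by (intro suminf_le b s sv)
      finally show "norm (\<Sum>m. \<Sum>k. A (k + K) m) \<le> (\<Sum>k. u (k + K)) * suminf v"
        using v by (simp add: suminf_mult)
    qed
    show "(\<lambda>K. (\<Sum>k. u (k + K)) * suminf v) \<longlonglongrightarrow> 0"
      using tendsto_mult[OF suminf_exist_split2[OF u] tendsto_const[of "suminf v"]] by simp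
  qed
  moreover have "(\<Sum>m. \<Sum>k. A (k + K) m) = (\<Sum>m. \<Sum>k. A k m) - (\<Sum>k<K. \<Sum>m. A k m)" for K
  proof -
    have "(\<Sum>k. A (k + K) m) = (\<Sum>k. A k m) - (\<Sum>k<K. A k m)" for m
      by (rule suminf_minus_initial_segment[OF c])
    hence "(\<Sum>m. \<Sum>k. A (k + K) m) = (\<Sum>m. (\<Sum>k. A k m) - (\<Sum>k<K. A k m))" by simp
    also have "\<dots> = (\<Sum>m. \<Sum>k. A k m) - (\<Sum>m. \<Sum>k<K. A k m)"
      by (intro suminf_diff[symmetric] s2 summable_sum r)
    also have "(\<Sum>m. \<Sum>k<K. A k m) = (\<Sum>k<K. \<Sum>m. A k m)" by (rule suminf_sum) (rule r)
    finally show ?thesis .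
  qed
  ultimately have "(\<lambda>K. (\<Sum>m. \<Sum>k. A k m) - (\<Sum>k<K. \<Sum>m. A k m)) \<longlonglongrightarrow> 0" by simp
  hence "(\<lambda>K. (\<Sum>m. \<Sum>k. A k m) - ((\<Sum>m. \<Sum>k. A k m) - (\<Sum>k<K. \<Sum>m. A k m))) \<longlonglongrightarrow> (\<Sum>m. \<Sum>k. A k m) - 0"
    by (intro tendsto_intros)
  hence "(\<lambda>k. \<Sum>m. A k m) sums (\<Sum>m. \<Sum>k. A k m)" by (simp add: sums_def)
  thus "(\<Sum>k. \<Sum>m. A k m) = (\<Sum>m. \<Sum>k. A k m)" by (simp add: sums_iff)
qed

lemma set_integral_sums:
  fixes f :: "nat \<Rightarrow> 'a \<Rightarrow> real" and M :: "'a measure"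
  assumes int: "\<And>i. set_integrable M A (f i)"
    and sums: "\<And>x. x \<in> A \<Longrightarrow> (\<lambda>i. f i x) sums s x"
    and abs: "\<And>x. x \<in> A \<Longrightarrow> summable (\<lambda>i. \<bar>f i x\<bar>)"
    and bound: "\<And>i. set_lebesgue_integral M A (\<lambda>x. \<bar>f i x\<bar>) \<le> B i" and B: "summable B"
  shows "set_integrable M A s" "(\<lambda>i. set_lebesgue_integral M A (f i)) sums set_lebesgue_integral M A s"
proof -
  let ?F = "\<lambda>i x. indicator A x *\<^sub>R f i x"
  have eq: "(\<Sum>i. ?F i x) = indicator A x *\<^sub>R s x" for x
    using sums by (auto simp: indicator_def sums_iff)
  have "norm (?F i x) = indicator A x *\<^sub>R \<bar>f i x\<bar>" for i x by (auto simp: indicator_def)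
  hence nrm: "(\<integral>x. norm (?F i x) \<partial>M) = set_lebesgue_integral M A (\<lambda>x. \<bar>f i x\<bar>)" for i
    by (simp add: set_lebesgue_integral_def)
  have 1: "integrable M (?F i)" for i using int by (simp add: set_integrable_def)
  have 2: "AE x in M. summable (\<lambda>i. norm (?F i x))"
    using abs by (intro AE_I2) (auto simp: indicator_def)
  have 3: "summable (\<lambda>i. \<integral>x. norm (?F i x) \<partial>M)"
  proof (rule summable_comparison_test'[OF B])
    show "norm (\<integral>x. norm (?F i x) \<partial>M) \<le> B i" for i
      using bound[of i] nrm[of i] Bochner_Integration.integral_nonneg[of M "\<lambda>x. norm (?F i x)"] by simp
  qed
  show "set_integrable M A s"
    using integrable_suminf[OF 1 2 3] unfolding eq set_integrable_def .
  show "(\<lambda>i. set_lebesgue_integral M A (f i)) sums set_lebesgue_integral M A s"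
    using sums_integral[OF 1 2 3] unfolding eq set_lebesgue_integral_def .
qed

section \<open>Partial fractions of the cotangent and the cosecant\<close>

text \<open>
  The logarithmic derivative of Euler's reflection formula reads
  \<open>\<psi>(1 - z) - \<psi>(z) = \<pi> cot (\<pi>z)\<close>, and in the limit formula for the digamma function the logarithms
  cancel in this difference.
\<close>
lemma pi_cot_partial_fractions_complex:
  fixes z :: complex
  assumes "z \<notin> \<int>"
  shows "(\<lambda>N. \<Sum>n<N. 1 / (z + of_nat n) - 1 / (1 - z + of_nat n)) \<longlonglongrightarrow> of_real pi * cot (of_real pi * z)"
proof -
  have nz: "sin (of_real pi * w) \<noteq> 0" "w \<notin> \<int>\<^sub>\<le>\<^sub>0" "1 - w \<notin> \<int>\<^sub>\<le>\<^sub>0" "w \<noteq> 0" "1 - w \<noteq> 0" if "w \<notin> \<int>" for w :: complex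
  proof -
    show "sin (of_real pi * w) \<noteq> 0" using that by (auto simp: sin_eq_0)
    show "w \<notin> \<int>\<^sub>\<le>\<^sub>0" using that nonpos_Ints_Int by blast
    show "w \<noteq> 0" using that by auto
    show "1 - w \<notin> \<int>\<^sub>\<le>\<^sub>0"
      using that nonpos_Ints_Int[of "1 - w"] Ints_diff[of 1 "1 - w"] by auto
    show "1 - w \<noteq> 0" using that by auto
  qed
  let ?G = "\<lambda>w::complex. Gamma w * Gamma (1 - w) * sin (of_real pi * w)"
  have const: "?G w = of_real pi" if "w \<notin> \<int>" for w
    using nz(1)[OF that] by (simp add: Gamma_reflection_complex)
  \<comment> \<open>\<open>?G\<close> is constant off the integers, and its derivative there is expressed by the digamma function.\<close>
  have "(?G has_field_derivative
      Gamma z * Gamma (1 - z) * ((Digamma z - Digamma (1 - z)) * sin (of_real pi * z)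
        + of_real pi * cos (of_real pi * z))) (at z)"
    using nz[OF assms] by (auto intro!: derivative_eq_intros simp: algebra_simps)
  moreover have "(?G has_field_derivative 0) (at z)"
  proof (rule DERIV_cong_ev[THEN iffD2, OF refl _ refl])
    have "open (- \<int> :: complex set)" using closed_Ints by (simp add: open_Compl)
    thus "\<forall>\<^sub>F w in nhds z. ?G w = of_real pi"
      using assms const by (intro eventually_nhds[THEN iffD2] exI[of _ "- \<int>"]) auto
  qed simp
  ultimately have *: "Gamma z * Gamma (1 - z) * ((Digamma z - Digamma (1 - z)) * sin (of_real pi * z)
        + of_real pi * cos (of_real pi * z)) = 0"
    by (rule DERIV_unique)
  have eq: "Digamma (1 - z) - Digamma z = of_real pi * cot (of_real pi * z)"
  proof -
    have "Gamma z * Gamma (1 - z) \<noteq> 0"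
      using nz[OF assms] by (simp add: Gamma_eq_zero_iff)
    hence "(Digamma z - Digamma (1 - z)) * sin (of_real pi * z) + of_real pi * cos (of_real pi * z) = 0"
      using * by simp
    hence "(Digamma (1 - z) - Digamma z) * sin (of_real pi * z) = of_real pi * cos (of_real pi * z)"
      by (simp add: algebra_simps)
    thus ?thesis using nz(1)[OF assms] by (simp add: cot_def eq_divide_eq)
  qed
  have "(\<lambda>N. (of_real (ln (real N)) - (\<Sum>n<N. inverse (1 - z + of_nat n)))
       - (of_real (ln (real N)) - (\<Sum>n<N. inverse (z + of_nat n)))) \<longlonglongrightarrow> Digamma (1 - z) - Digamma z"
    using nz[OF assms] by (intro tendsto_diff Digamma_LIMSEQ)
  thus ?thesis unfolding eq by (simp add: sum_subtractf inverse_eq_divide)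
qed

lemma pi_cot_partial_fractions:
  fixes z :: real
  assumes "z \<notin> \<int>"
  shows "(\<lambda>N. \<Sum>n<N. 1 / (z + real n) - 1 / (1 - z + real n)) \<longlonglongrightarrow> pi * cot (pi * z)"
proof -
  have "complex_of_real z \<notin> \<int>" using assms by simp
  from tendsto_Re[OF pi_cot_partial_fractions_complex[OF this]]
  have "(\<lambda>N. Re (\<Sum>n<N. 1 / (of_real z + of_nat n) - 1 / (1 - of_real z + of_nat n))) \<longlonglongrightarrow>
      Re (of_real pi * cot (of_real pi * of_real z))" .
  moreover have "Re (\<Sum>n<N. 1 / (of_real z + of_nat n) - 1 / (1 - of_real z + of_nat n)) =
      (\<Sum>n<N. 1 / (z + real n) - 1 / (1 - z + real n))" for N
  proof -
    have "(\<Sum>n<N. 1 / (of_real z + of_nat n) - 1 / (1 - of_real z + of_nat n)) =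
      complex_of_real (\<Sum>n<N. 1 / (z + real n) - 1 / (1 - z + real n))" by simp
    thus ?thesis by (simp only: Re_complex_of_real)
  qed
  moreover have "Re (of_real pi * cot (of_real pi * of_real z)) = pi * cot (pi * z)"
  proof -
    have "of_real pi * cot (of_real pi * of_real z) = complex_of_real (pi * cot (pi * z))"
      by (simp add: cot_def flip: sin_of_real cos_of_real)
    thus ?thesis by (simp only: Re_complex_of_real)
  qed
  ultimately show ?thesis by simp
qed

text \<open>
  From \<open>2 / sin (2x) = cot x + cot (\<pi>/2 - x)\<close>: the terms of index \<open>n\<close> of the cotangent series
  at \<open>z/2\<close> and at \<open>(1 - z)/2\<close> together are the terms of indices \<open>2n\<close> and \<open>2n + 1\<close> here, which is why
  the partial sums have even length.
\<close>
lemma pi_csc_partial_fractions: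
  fixes z :: real
  assumes "z \<notin> \<int>"
  shows "(\<lambda>N. \<Sum>j<2*N. (-1)^j * (1 / (z + real j) + 1 / (real j + 1 - z))) \<longlonglongrightarrow> pi / sin (pi * z)"
proof -
  have n1: "z / 2 \<notin> \<int>" "(1 - z) / 2 \<notin> \<int>"
  proof -
    show "z / 2 \<notin> \<int>"
    proof
      assume "z / 2 \<in> \<int>"
      hence "2 * (z / 2) \<in> \<int>" by (intro Ints_mult) auto
      thus False using assms by simp
    qed
    show "(1 - z) / 2 \<notin> \<int>"
    proof
      assume "(1 - z) / 2 \<in> \<int>"
      hence "1 - 2 * ((1 - z) / 2) \<in> \<int>" by (intro Ints_mult Ints_diff) auto
      moreover have "1 - 2 * ((1 - z) / 2) = z" by (simp add: field_simps)
      ultimately show False using assms by metis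
    qed
  qed
  have sc: "sin (pi * z / 2) \<noteq> 0" "cos (pi * z / 2) \<noteq> 0"
  proof -
    have "sin (pi * z) \<noteq> 0"
    proof
      assume "sin (pi * z) = 0"
      then obtain i :: int where "pi * z = of_int i * pi" unfolding sin_zero_iff_int2 by blast
      hence "z = of_int i" by simp
      thus False using assms by simp
    qed
    moreover have "sin (pi * z) = 2 * sin (pi * z / 2) * cos (pi * z / 2)"
      using sin_double[of "pi * z / 2"] by simp
    ultimately show "sin (pi * z / 2) \<noteq> 0" "cos (pi * z / 2) \<noteq> 0" by auto
  qed
  have "pi * cot (pi * (z / 2)) + pi * cot (pi * ((1 - z) / 2)) = 2 * (pi / sin (pi * z))"
  proof -
    define s c where "s = sin (pi * z / 2)" and "c = cos (pi * z / 2)"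
    have arg: "pi * ((1 - z) / 2) = pi / 2 - pi * z / 2" by (simp add: field_simps)
    have 1: "cot (pi * ((1 - z) / 2)) = s / c"
      unfolding arg cot_def s_def c_def by (simp add: cos_sin_eq[of "pi * z / 2"] sin_cos_eq[of "pi * z / 2"])
    have 2: "cot (pi * (z / 2)) = c / s" by (simp add: cot_def s_def c_def)
    have 3: "sin (pi * z) = 2 * s * c"
      using sin_double[of "pi * z / 2"] by (simp add: s_def c_def)
    have 4: "c * c + s * s = 1"
      by (simp add: s_def c_def flip: power2_eq_square)
    have "s \<noteq> 0" "c \<noteq> 0" using sc by (simp_all add: s_def c_def)
    hence "pi * (c / s) + pi * (s / c) = pi * (c * c + s * s) / (s * c)"
      by (simp add: divide_simps) (simp add: algebra_simps)
    thus ?thesis unfolding 1 2 3 4 by simp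
  qed
  moreover have "(\<lambda>N. (\<Sum>n<N. 1 / (z/2 + real n) - 1 / (1 - z/2 + real n)) +
      (\<Sum>n<N. 1 / ((1-z)/2 + real n) - 1 / (1 - (1-z)/2 + real n)))
      \<longlonglongrightarrow> pi * cot (pi * (z / 2)) + pi * cot (pi * ((1 - z) / 2))"
    by (intro tendsto_add pi_cot_partial_fractions n1)
  moreover have "(\<Sum>n<N. 1 / (z/2 + real n) - 1 / (1 - z/2 + real n)) +
      (\<Sum>n<N. 1 / ((1-z)/2 + real n) - 1 / (1 - (1-z)/2 + real n))
     = 2 * (\<Sum>j<2*N. (-1)^j * (1 / (z + real j) + 1 / (real j + 1 - z)))" for N
  proof (induction N)
    case (Suc N)
    have h: "1 / (x / 2) = 2 / x" for x :: real by simp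
    have e: "1 / (z/2 + real N) = 2 / (z + real (2*N))"
         "1 / (1 - z/2 + real N) = 2 / (real (2*N+1) + 1 - z)"
         "1 / ((1-z)/2 + real N) = 2 / (real (2*N) + 1 - z)"
         "1 / (1 - (1-z)/2 + real N) = 2 / (z + real (2*N+1))"
      by (subst h[symmetric], rule arg_cong[of _ _ "\<lambda>x. 1 / x"], simp add: field_simps)+
    have "(\<Sum>j<2 * Suc N. (-1)^j * (1 / (z + real j) + 1 / (real j + 1 - z))) =
      (\<Sum>j<2 * N. (-1)^j * (1 / (z + real j) + 1 / (real j + 1 - z)))
        + (1 / (z + real (2*N)) + 1 / (real (2*N) + 1 - z))
        - (1 / (z + real (2*N+1)) + 1 / (real (2*N+1) + 1 - z))"
      by simp
    thus ?case using Suc.IH unfolding sum.lessThan_Suc e by simp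
  qed simp
  ultimately have "(\<lambda>N. 2 * (\<Sum>j<2*N. (-1)^j * (1 / (z + real j) + 1 / (real j + 1 - z)))) \<longlonglongrightarrow> 2 * (pi / sin (pi * z))"
    by simp
  from tendsto_mult[OF tendsto_const[of "1/2"] this] show ?thesis by simp
qed

lemma summable_inverse_square_Suc: "summable (\<lambda>k. 1 / real (Suc k)^2)"
proof -
  have "summable (\<lambda>n. inverse (real n ^ 2))" by (rule inverse_power_summable) simp
  thus ?thesis by (subst summable_Suc_iff) (simp add: inverse_eq_divide)
qed

text \<open>
  The cosecant series at \<open>z = s/\<alpha>\<close>, without its term \<open>1/z\<close> and with the denominators \<open>k - z\<close> and
  \<open>k + z\<close> combined. In this symmetric form the terms are of order \<open>1/k\<^sup>2\<close>, so the limit along even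
  partial sums is the sum.
\<close>
lemma pi_csc_partial_fractions_scaled:
  fixes \<alpha> s :: real
  assumes \<alpha>: "\<alpha> > 0" and s: "s > 0" and sZ: "s / \<alpha> \<notin> \<int>"
  shows "(\<lambda>k. (-1)^k / real (Suc k) * (1 / (\<alpha> * real (Suc k) - s) + 1 / (\<alpha> * real (Suc k) + s)))
           sums (pi / (s * sin (s * pi / \<alpha>)) - \<alpha> / s^2)"
proof -
  define z where "z = s / \<alpha>"
  have z0: "z > 0" and zZ: "z \<notin> \<int>" and sz: "s = \<alpha> * z" using assms by (auto simp: z_def)
  let ?t = "\<lambda>k. (-1)^k / real (Suc k) * (1 / (\<alpha> * real (Suc k) - s) + 1 / (\<alpha> * real (Suc k) + s))"
  have nz: "real (Suc k) - z \<noteq> 0" for k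
  proof
    assume "real (Suc k) - z = 0"
    hence "z = of_int (int (Suc k))" by simp
    thus False using zZ Ints_of_int by metis
  qed
  have t: "?t k = 1 / s * ((-1)^k * (1 / (real (Suc k) - z) - 1 / (real (Suc k) + z)))" for k
  proof -
    define n where "n = real (Suc k)"
    have n: "n > 0" "n - z \<noteq> 0" "n + z > 0" using nz[of k] z0 by (auto simp: n_def)
    have "1 / (\<alpha> * n - s) + 1 / (\<alpha> * n + s) = n / s * (1 / (n - z) - 1 / (n + z))"
    proof -
      have "1 / (\<alpha> * n - s) + 1 / (\<alpha> * n + s) = 1 / \<alpha> * (1 / (n - z) + 1 / (n + z))"
        unfolding sz by (simp add: distrib_left flip: right_diff_distrib)
      also have "1 / (n - z) + 1 / (n + z) = n / z * (1 / (n - z) - 1 / (n + z))"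
        using n z0 by (simp add: divide_simps)
      finally show ?thesis using \<alpha> by (simp add: sz)
    qed
    thus ?thesis using n(1) unfolding n_def[symmetric] by simp
  qed
  have sm: "summable ?t"
  proof (rule summable_comparison_test_bigo)
    show "summable (\<lambda>k. norm (1 / real (Suc k)^2))" using summable_inverse_square_Suc by simp
    have "(\<lambda>k. 1 / real (Suc k) * (1 / (\<alpha> * real (Suc k) - s) + 1 / (\<alpha> * real (Suc k) + s))) \<in> O(\<lambda>k. 1 / real (Suc k)^2)"
      using \<alpha> by real_asymp
    then obtain c where "\<forall>\<^sub>F k in sequentially. norm (1 / real (Suc k) * (1 / (\<alpha> * real (Suc k) - s) + 1 / (\<alpha> * real (Suc k) + s)))
        \<le> c * norm (1 / real (Suc k)^2)"
      by (elim landau_o.bigE)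
    hence "\<forall>\<^sub>F k in sequentially. norm (?t k) \<le> c * norm (1 / real (Suc k)^2)"
      by (simp add: abs_mult)
    thus "?t \<in> O(\<lambda>k. 1 / real (Suc k)^2)" by (rule bigoI)
  qed
  have part: "(\<Sum>k<n. (-1)^k * (1 / (real (Suc k) - z) - 1 / (real (Suc k) + z))) =
     (\<Sum>j<n. (-1)^j * (1 / (z + real j) + 1 / (real j + 1 - z))) - 1 / z + (-1)^n / (z + real n)" for n
    by (induction n) (simp_all add: algebra_simps)
  have sub: "filterlim (\<lambda>N::nat. 2 * N) sequentially sequentially"
    by (rule filterlim_subseq) (auto simp: strict_mono_def)
  have "(\<lambda>N. 1 / s * ((\<Sum>j<2*N. (-1)^j * (1 / (z + real j) + 1 / (real j + 1 - z))) - 1 / z + (-1)^(2*N) / (z + real (2*N))))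
     \<longlonglongrightarrow> 1 / s * (pi / sin (pi * z) - 1 / z + 0)"
  proof (intro tendsto_intros pi_csc_partial_fractions zZ)
    show "(\<lambda>N. (-1)^(2*N) / (z + real (2*N))) \<longlonglongrightarrow> 0"
      using z0 by simp real_asymp
  qed
  hence "(\<lambda>N. \<Sum>k<2*N. ?t k) \<longlonglongrightarrow> 1 / s * (pi / sin (pi * z) - 1 / z + 0)"
    unfolding t sum_distrib_left[symmetric] part .
  moreover have "(\<lambda>N. \<Sum>k<2*N. ?t k) \<longlonglongrightarrow> suminf ?t"
    using filterlim_compose[OF summable_LIMSEQ[OF sm] sub] .
  ultimately have "suminf ?t = 1 / s * (pi / sin (pi * z) - 1 / z + 0)"
    using LIMSEQ_unique by blast
  also have "\<dots> = pi / (s * sin (s * pi / \<alpha>)) - \<alpha> / s^2"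
    using s by (simp add: z_def right_diff_distrib power2_eq_square mult_ac)
  finally show ?thesis using sm by (simp add: sums_iff)
qed

section \<open>The Stieltjes transform of a power on the unit interval\<close>

text \<open>
  This is used with \<open>x\<close> and \<open>w\<close> in either role, as an expansion in powers of \<open>x/w\<close> or of \<open>w/x\<close>.
\<close>
lemma truncated_geometric_expansion:
  fixes x w :: real
  assumes "w > 0" "x \<ge> 0"
  shows "1 / (x + w) - (\<Sum>n<M. (-1)^n * x^n / w^(n+1)) = (-1)^M * (x/w)^M / (x + w)"
proof (induction M)
  case (Suc M)
  have "1 / (x + w) - (\<Sum>n<Suc M. (-1)^n * x^n / w^(n+1)) =
      (-1)^M * (x/w)^M / (x + w) - (-1)^M * x^M / w^(M+1)"
    using Suc.IH by simp
  also have "(-1)^M * x^M / w^(M+1) = (-1)^M * (x/w)^M / w"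
    by (simp add: power_divide)
  also have "(-1)^M * (x/w)^M / (x + w) - (-1)^M * (x/w)^M / w = (-1)^M * (x/w)^M * (1 / (x + w) - 1 / w)"
    by (simp add: right_diff_distrib)
  also have "1 / (x + w) - 1 / w = - (x / w) / (x + w)"
    using assms by (simp add: field_simps)
  finally show ?case by simp
qed simp

text \<open>
  On \<open>[0,w]\<close> the factor \<open>1/(x + w)\<close> is expanded in powers of \<open>x/w\<close>. The remainder tends to \<open>0\<close> even though the
  geometric series itself diverges at the end point \<open>x = w\<close>.
\<close>
lemma stieltjes_expansion_below:
  fixes a w :: real
  assumes a: "a > 0" and w: "w > 0"
  shows "\<bar>integral {0..w} (\<lambda>x. x powr a / (x + w)) - w powr a * (\<Sum>n<M. (-1)^n / (a + 1 + real n))\<bar>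
           \<le> w powr a / (a + 1 + real M)"
proof -
  let ?p = "\<lambda>x. \<Sum>n<M. (-1)^n / w^(n+1) * x powr (a + real n)"
  have "(?p has_integral (\<Sum>n<M. (-1)^n / w^(n+1) * (w powr (a + real n + 1) / (a + real n + 1)))) {0..w}"
    using a w by (intro has_integral_sum has_integral_mult_right has_integral_powr_from_0) auto
  also have "(\<Sum>n<M. (-1)^n / w^(n+1) * (w powr (a + real n + 1) / (a + real n + 1)))
      = w powr a * (\<Sum>n<M. (-1)^n / (a + 1 + real n))"
    unfolding sum_distrib_left
  proof (intro sum.cong refl)
    fix n
    have "w powr (a + real n + 1) = w powr a * w^(n+1)"
      using w powr_add[of w a "real (n+1)"] powr_realpow[of w "n+1"] by (simp add: add_ac)
    thus "(-1)^n / w^(n+1) * (w powr (a + real n + 1) / (a + real n + 1)) = w powr a * ((-1)^n / (a + 1 + real n))"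
      using w by (simp add: add_ac)
  qed
  finally have p: "(?p has_integral w powr a * (\<Sum>n<M. (-1)^n / (a + 1 + real n))) {0..w}" .
  have f: "(\<lambda>x. x powr a / (x + w)) integrable_on {0..w}"
    using a w by (intro integrable_continuous_interval continuous_on_divide continuous_on_powr' continuous_intros) auto
  have "((\<lambda>x. 1 / w^(M+1) * x powr (a + real M)) has_integral
      (1 / w^(M+1) * (w powr (a + real M + 1) / (a + real M + 1)))) {0..w}"
    using a w by (intro has_integral_mult_right has_integral_powr_from_0) auto
  also have "1 / w^(M+1) * (w powr (a + real M + 1) / (a + real M + 1)) = w powr a / (a + 1 + real M)"
  proof -
    have "w powr (a + real M + 1) = w powr a * w^(M+1)"
      using w powr_add[of w a "real (M+1)"] powr_realpow[of w "M+1"] by (simp add: add_ac)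
    thus ?thesis using w by (simp add: add_ac)
  qed
  finally have b: "((\<lambda>x. 1 / w^(M+1) * x powr (a + real M)) has_integral w powr a / (a + 1 + real M)) {0..w}" .
  have "norm (x powr a / (x + w) - ?p x) \<le> 1 / w^(M+1) * x powr (a + real M)" if x: "x \<in> {0..w}" for x
  proof -
    have pw: "x powr (a + real n) = x powr a * x^n" for n
      using x a by (cases "x = 0") (auto simp: powr_add powr_realpow)
    have "x powr a / (x + w) - ?p x = x powr a * (1 / (x + w) - (\<Sum>n<M. (-1)^n * x^n / w^(n+1)))"
      unfolding pw right_diff_distrib sum_distrib_left
      by (intro arg_cong2[of _ _ _ _ "(-)"] sum.cong) (auto simp: mult_ac)
    also have "\<dots> = x powr a * ((-1)^M * (x/w)^M / (x + w))"
      using x w by (subst truncated_geometric_expansion) auto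
    also have "norm \<dots> = x powr a * (x/w)^M / (x + w)"
      using x w by (simp add: abs_mult power_abs)
    also have "\<dots> \<le> x powr a * (x/w)^M / w"
      using x w by (intro divide_left_mono) auto
    finally show ?thesis using w by (simp add: pw power_divide mult_ac)
  qed
  from integral_norm_bound_integral[OF integrable_diff[OF f has_integral_integrable[OF p]] has_integral_integrable[OF b] this]
  show ?thesis
    unfolding integral_diff[OF f has_integral_integrable[OF p]] integral_unique[OF p] integral_unique[OF b] real_norm_def .
qed

text \<open>
  On \<open>[w,1]\<close> the factor \<open>1/(x + w)\<close> is expanded in powers of \<open>w/x\<close>. The values of the primitives at \<open>x = 1\<close>
  give the power series in \<open>w\<close>; all those at \<open>x = w\<close> are multiples of the same power \<open>w\<^sup>a\<close>.
\<close>
lemma stieltjes_expansion_above: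
  fixes a w :: real
  assumes a: "a \<notin> \<int>" and w: "0 < w" "w \<le> 1" and M: "real M > a"
  shows "\<bar>integral {w..1} (\<lambda>x. x powr a / (x + w))
            - (\<Sum>m<M. (-w)^m / (a - real m)) + w powr a * (\<Sum>m<M. (-1)^m / (a - real m))\<bar>
           \<le> w powr a / (real M - a)"
proof -
  have nz: "a - real m \<noteq> 0" for m using a by auto
  have powr_int: "((\<lambda>x. x powr (a - real m - 1)) has_integral (1 - w powr (a - real m)) / (a - real m)) {w..1}" for m
  proof -
    have "((\<lambda>x. x powr (a - real m - 1)) has_integral
        (1 powr (a - real m) / (a - real m) - w powr (a - real m) / (a - real m))) {w..1}"
    proof (rule fundamental_theorem_of_calculus[OF w(2)])
      fix x assume "x \<in> {w..1}"
      hence "x > 0" using w by simp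
      hence "((\<lambda>x. x powr (a - real m) / (a - real m)) has_real_derivative x powr (a - real m - 1)) (at x within {w..1})"
        using nz[of m] DERIV_cdivide[OF has_real_derivative_powr[of x "a - real m"], of "a - real m"]
        by (auto intro: has_field_derivative_at_within)
      thus "((\<lambda>x. x powr (a - real m) / (a - real m)) has_vector_derivative x powr (a - real m - 1)) (at x within {w..1})"
        by (simp add: has_real_derivative_iff_has_vector_derivative)
    qed
    thus ?thesis by (simp add: diff_divide_distrib)
  qed
  have wp: "w^m * w powr (a - real m) = w powr a" for m
    using w powr_add[of w "real m" "a - real m"] by (simp add: powr_realpow)
  let ?p = "\<lambda>x. \<Sum>m<M. (-w)^m * x powr (a - real m - 1)"
  have "(?p has_integral (\<Sum>m<M. (-w)^m * ((1 - w powr (a - real m)) / (a - real m)))) {w..1}"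
    by (intro has_integral_sum has_integral_mult_right powr_int) auto
  also have "(\<Sum>m<M. (-w)^m * ((1 - w powr (a - real m)) / (a - real m))) =
      (\<Sum>m<M. (-w)^m / (a - real m)) - w powr a * (\<Sum>m<M. (-1)^m / (a - real m))"
    unfolding sum_distrib_left sum_subtractf[symmetric]
  proof (intro sum.cong refl)
    fix m
    have "(-w)^m * ((1 - w powr (a - real m)) / (a - real m))
        = (-w)^m / (a - real m) - (-1)^m * (w^m * w powr (a - real m)) / (a - real m)"
      by (simp add: power_minus[of w] diff_divide_distrib right_diff_distrib mult_ac)
    thus "(-w)^m * ((1 - w powr (a - real m)) / (a - real m))
        = (-w)^m / (a - real m) - w powr a * ((-1)^m / (a - real m))"
      unfolding wp by simp
  qed
  finally have p: "(?p has_integral (\<Sum>m<M. (-w)^m / (a - real m)) - w powr a * (\<Sum>m<M. (-1)^m / (a - real m))) {w..1}" .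
  have f: "(\<lambda>x. x powr a / (x + w)) integrable_on {w..1}"
    using w by (intro integrable_continuous_interval continuous_intros) auto
  have b: "((\<lambda>x. w^M * x powr (a - real M - 1)) has_integral w^M * ((1 - w powr (a - real M)) / (a - real M))) {w..1}"
    by (intro has_integral_mult_right powr_int)
  have bval: "w^M * ((1 - w powr (a - real M)) / (a - real M)) \<le> w powr a / (real M - a)"
  proof -
    have "w^M * ((1 - w powr (a - real M)) / (a - real M)) = (w^M - w powr a) / (a - real M)"
      using wp[of M] by (simp add: algebra_simps)
    also have "\<dots> = (w powr a - w^M) / (real M - a)"
      using M by (simp add: field_simps)
    also have "\<dots> \<le> w powr a / (real M - a)"
      using M w by (intro divide_right_mono) auto
    finally show ?thesis .
  qed
  have "norm (x powr a / (x + w) - ?p x) \<le> w^M * x powr (a - real M - 1)" if x: "x \<in> {w..1}" for x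
  proof -
    have x0: "x > 0" using x w by auto
    have pw: "x powr (a - real n - 1) = x powr a / x^(n+1)" for n
      using x0 powr_diff[of x a "real (n+1)"] powr_realpow[of x "n+1"] by (simp add: algebra_simps)
    have "x powr a / (x + w) - ?p x = x powr a * (1 / (w + x) - (\<Sum>n<M. (-1)^n * w^n / x^(n+1)))"
      unfolding pw right_diff_distrib sum_distrib_left
      by (intro arg_cong2[of _ _ _ _ "(-)"] sum.cong) (auto simp: mult_ac add_ac power_minus[of w])
    also have "\<dots> = x powr a * ((-1)^M * (w/x)^M / (w + x))"
      using x0 w by (subst truncated_geometric_expansion) auto
    also have "norm \<dots> = x powr a * (w/x)^M / (w + x)"
      using x0 w by (simp add: abs_mult power_abs)
    also have "\<dots> \<le> x powr a * (w/x)^M / x"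
      using x0 w by (intro divide_left_mono) auto
    finally show ?thesis using x0 by (simp add: pw power_divide mult_ac)
  qed
  from integral_norm_bound_integral[OF integrable_diff[OF f has_integral_integrable[OF p]] has_integral_integrable[OF b] this]
  have "\<bar>integral {w..1} (\<lambda>x. x powr a / (x + w)) - ((\<Sum>m<M. (-w)^m / (a - real m)) - w powr a * (\<Sum>m<M. (-1)^m / (a - real m)))\<bar>
    \<le> w^M * ((1 - w powr (a - real M)) / (a - real M))"
    unfolding integral_diff[OF f has_integral_integrable[OF p]] integral_unique[OF p] integral_unique[OF b] real_norm_def .
  thus ?thesis using bval by linarith
qed

lemma summable_power_over_shifted_index:
  fixes z :: "'a :: {real_normed_field, banach}" and a :: real
  assumes "norm z < 1"
  shows "summable (\<lambda>m. z^m / of_real (a - real m))"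
proof (rule summable_comparison_test_ev)
  show "summable (\<lambda>m. norm z ^ m)" using assms by (intro summable_geometric) simp
  show "\<forall>\<^sub>F m in sequentially. norm (z^m / of_real (a - real m)) \<le> norm z ^ m"
    using eventually_ge_at_top[of "nat \<lceil>a + 1\<rceil>"]
  proof eventually_elim
    case (elim m)
    hence "\<bar>a - real m\<bar> \<ge> 1" by linarith
    thus ?case by (simp add: norm_divide norm_power divide_le_eq mult_le_cancel_left1 del: of_real_diff)
  qed
qed

text \<open>
  The two multiples of \<open>w\<^sup>a\<close> that arise at \<open>x = w\<close>, from the left and from the right, are the two
  halves of the partial fraction series of \<open>\<pi> / sin (\<pi>z)\<close> at \<open>z = -a\<close>.
\<close>
lemma stieltjes_powr_integral_real:
  fixes a w :: real
  assumes a: "a > 0" "a \<notin> \<int>" and w: "0 < w" "w < 1"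
  shows "integral {0..1} (\<lambda>x. x powr a / (x + w)) =
           (\<Sum>m. (-w)^m / (a - real m)) - pi * w powr a / sin (pi * a)"
proof -
  let ?f = "\<lambda>x. x powr a / (x + w)"
  let ?I1 = "integral {0..w} ?f" and ?I2 = "integral {w..1} ?f"
  let ?c = "\<lambda>N. \<Sum>j<2*N. (-1)^j * (1 / (-a + real j) + 1 / (real j + 1 - (-a)))"
  let ?s = "\<lambda>N. \<Sum>m<2*N. (-w)^m / (a - real m)"
  have "?f integrable_on {0..1}"
    using a w by (intro integrable_continuous_interval continuous_on_divide continuous_on_powr' continuous_intros) auto
  hence split: "integral {0..1} ?f = ?I1 + ?I2"
    using w by (intro Henstock_Kurzweil_Integration.integral_combine[symmetric]) auto
  have "- a \<notin> \<int>" using a(2) by (simp add: minus_in_Ints_iff)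
  hence csc: "?c \<longlonglongrightarrow> pi / sin (pi * (-a))" by (rule pi_csc_partial_fractions)
  have sub: "filterlim (\<lambda>N::nat. 2 * N) sequentially sequentially"
    by (rule filterlim_subseq) (auto simp: strict_mono_def)
  have "summable (\<lambda>m. (-w)^m / (a - real m))"
    using summable_power_over_shifted_index[of "-w" a] w by simp
  hence ser: "?s \<longlonglongrightarrow> (\<Sum>m. (-w)^m / (a - real m))"
    using filterlim_compose[OF summable_LIMSEQ sub] by blast
  \<comment> \<open>Truncating at an even index makes the multiples of \<open>w powr a\<close> a partial sum \<open>?c N\<close> of the cosecant series.\<close>
  have "(\<lambda>N. ?I1 + ?I2 - ?s N - w powr a * ?c N) \<longlonglongrightarrow> 0"
  proof (rule Lim_null_comparison)
    show "\<forall>\<^sub>F N in sequentially. norm (?I1 + ?I2 - ?s N - w powr a * ?c N) \<le>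
        w powr a / (a + 1 + real (2*N)) + w powr a / (real (2*N) - a)"
      using eventually_gt_at_top[of "nat \<lceil>a\<rceil>"]
    proof eventually_elim
      case (elim N)
      have "?c N = (\<Sum>n<2*N. (-1)^n / (a + 1 + real n)) - (\<Sum>m<2*N. (-1)^m / (a - real m))"
        unfolding sum_subtractf[symmetric]
      proof (intro sum.cong refl)
        fix j
        have "-a + real j = -(a - real j)" by simp
        hence "1 / (-a + real j) = - (1 / (a - real j))" by (metis minus_divide_right)
        thus "(-1)^j * (1 / (-a + real j) + 1 / (real j + 1 - (-a))) = (-1)^j / (a + 1 + real j) - (-1)^j / (a - real j)"
          by (simp add: algebra_simps)
      qed
      hence c: "w powr a * ?c N = w powr a * (\<Sum>n<2*N. (-1)^n / (a + 1 + real n)) - w powr a * (\<Sum>m<2*N. (-1)^m / (a - real m))"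
        by (simp add: right_diff_distrib)
      have "real (2*N) > a" using elim a by linarith
      from stieltjes_expansion_below[OF a(1) w(1), of "2*N"] stieltjes_expansion_above[OF a(2) w(1) less_imp_le[OF w(2)] this]
      show ?case unfolding c real_norm_def by linarith
    qed
    have "filterlim (\<lambda>N. a + 1 + real (2*N)) at_top sequentially" "filterlim (\<lambda>N. real (2*N) - a) at_top sequentially"
      by real_asymp+
    hence "(\<lambda>N. w powr a / (a + 1 + real (2*N)) + w powr a / (real (2*N) - a)) \<longlonglongrightarrow> 0 + 0"
      by (intro tendsto_add real_tendsto_divide_at_top[OF tendsto_const])
    thus "(\<lambda>N. w powr a / (a + 1 + real (2*N)) + w powr a / (real (2*N) - a)) \<longlonglongrightarrow> 0" by simp
  qed
  moreover have "(\<lambda>N. ?I1 + ?I2 - ?s N - w powr a * ?c N) \<longlonglongrightarrow>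
      ?I1 + ?I2 - (\<Sum>m. (-w)^m / (a - real m)) - w powr a * (pi / sin (pi * (-a)))"
    by (intro tendsto_intros csc ser)
  ultimately have "?I1 + ?I2 - (\<Sum>m. (-w)^m / (a - real m)) - w powr a * (pi / sin (pi * (-a))) = 0"
    using LIMSEQ_unique by blast
  thus ?thesis unfolding split by (simp add: mult_ac)
qed

text \<open>
  Both sides are holomorphic in \<open>w\<close> and agree on \<open>(0,1)\<close>. The half disc with axis \<open>e\<^bsup>i\<theta>/2\<^esup>\<close> is chosen
  as domain because it is convex, contains \<open>(0,1)\<close> and the points \<open>\<beta> e\<^sup>i\<^sup>\<theta>\<close>, and does not meet the branch
  cut of the power, on which the poles \<open>-x\<close> of the integrand lie.
\<close>
lemma stieltjes_powr_integral:
  fixes a \<theta> :: real and w :: complex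
  assumes a: "a > 0" "a \<notin> \<int>" and \<theta>: "0 < \<theta>" "\<theta> < pi"
    and w: "norm w < 1" "Re (cis (-\<theta>/2) * w) > 0"
  shows "integral {0..1} (\<lambda>t. of_real (t powr a) / (of_real t + w)) =
           (\<Sum>m. (-w)^m / of_real (a - real m)) - of_real (pi / sin (pi * a)) * w powr of_real a"
proof -
  define U where "U = ball 0 1 \<inter> {w. Re (cis (-\<theta>/2) * w) > 0}"
  have cos_pos: "cos (\<theta>/2) > 0" using \<theta> by (intro cos_gt_zero) auto
  have half: "{w. Re (cis (-\<theta>/2) * w) > 0} = {w. cnj (cis (-\<theta>/2)) \<bullet> w > 0}"
    by (simp add: inner_complex_def)
  have "open U" unfolding U_def half by (intro open_Int open_ball open_halfspace_gt)
  have "convex U" unfolding U_def half by (intro convex_Int convex_ball convex_halfspace_gt)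
  have slit: "z \<notin> \<real>\<^sub>\<le>\<^sub>0" if "z \<in> U" for z
  proof
    assume "z \<in> \<real>\<^sub>\<le>\<^sub>0"
    then obtain r where "z = of_real r" "r \<le> 0" by (auto elim: nonpos_Reals_cases)
    thus False using that cos_pos by (simp add: U_def zero_less_mult_iff)
  qed
  have nz: "of_real t + z \<noteq> 0" if "z \<in> U" "t \<in> {0..1}" for z t
  proof
    assume "of_real t + z = 0"
    hence "z = of_real (-t)" by (simp add: add_eq_0_iff2)
    moreover have "of_real (-t) \<in> \<real>\<^sub>\<le>\<^sub>0" using that(2) by (subst nonpos_Reals_of_real_iff) auto
    ultimately show False using slit that(1) by metis
  qed
  have real_in_U: "of_real r \<in> U \<longleftrightarrow> 0 < r \<and> r < 1" for r
    using cos_pos by (auto simp: U_def zero_less_mult_iff)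
  let ?H = "\<lambda>z::complex. integral {0..1} (\<lambda>t. of_real (t powr a) / (of_real t + z))"
  let ?S = "\<lambda>z::complex. \<Sum>m. (-z)^m / of_real (a - real m)"
  let ?R = "\<lambda>z. ?S z - of_real (pi / sin (pi * a)) * z powr of_real a"
  have H: "?H holomorphic_on U"
  proof -
    have cont: "continuous_on {0..1} (\<lambda>t. complex_of_real (t powr a))"
      using a by (intro continuous_on_of_real continuous_on_powr' continuous_intros) auto
    have "(\<lambda>z. integral (cbox 0 1) (\<lambda>t. of_real (t powr a) / (of_real t + z))) holomorphic_on U"
    proof (rule leibniz_rule_holomorphic[OF _ _ _ \<open>convex U\<close>])
      fix z t assume "z \<in> U" "t \<in> cbox 0 (1::real)"
      with nz have "of_real t + z \<noteq> 0" by auto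
      thus "((\<lambda>z. of_real (t powr a) / (of_real t + z)) has_field_derivative
              - of_real (t powr a) / (of_real t + z)^2) (at z within U)"
        by (auto intro!: derivative_eq_intros simp: power2_eq_square)
    next
      fix z assume "z \<in> U"
      with nz show "(\<lambda>t. of_real (t powr a) / (of_real t + z)) integrable_on cbox 0 (1::real)"
        using cont unfolding cbox_interval
        by (intro integrable_continuous_interval continuous_on_divide[OF cont] continuous_intros) auto
    next
      have c: "continuous_on (U \<times> cbox 0 1) (\<lambda>p. complex_of_real (snd p powr a))"
        by (rule continuous_on_compose2[OF cont]) (auto intro!: continuous_intros)
      show "continuous_on (U \<times> cbox 0 1) (\<lambda>(z, t). - of_real (t powr a) / (of_real t + z)^2)"
        unfolding case_prod_unfold using nz
        by (intro continuous_on_divide[OF continuous_on_minus[OF c]] continuous_intros) auto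
    qed
    thus ?thesis by simp
  qed
  have S: "?S holomorphic_on U"
  proof -
    have "?S holomorphic_on ball 0 1"
    proof (rule power_series_holomorphic)
      fix z :: complex assume "z \<in> ball 0 1"
      hence "(\<lambda>m. (-z)^m / of_real (a - real m)) sums ?S z"
        by (intro summable_sums summable_power_over_shifted_index) auto
      thus "(\<lambda>m. (-1)^m / of_real (a - real m) * (z - 0)^m) sums ?S z"
        by (simp add: power_minus[of z])
    qed
    thus ?thesis by (rule holomorphic_on_subset) (auto simp: U_def)
  qed
  have R: "?R holomorphic_on U"
    using slit by (intro holomorphic_intros S) auto
  have eq: "?H (of_real r) - ?R (of_real r) = 0" if r: "0 < r" "r < 1" for r :: real
  proof -
    have "(\<lambda>x. x powr a / (x + r)) integrable_on {0..1}"
      using a r by (intro integrable_continuous_interval continuous_on_divide continuous_on_powr' continuous_intros) auto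
    from has_integral_of_real[OF integrable_integral[OF this], where 'b = complex]
    have "?H (of_real r) = of_real (integral {0..1} (\<lambda>x. x powr a / (x + r)))"
      by (simp add: integral_unique)
    moreover have "?S (of_real r) = of_real (\<Sum>m. (-r)^m / (a - real m))"
      using summable_power_over_shifted_index[of "-r" a] r
      by (subst suminf_of_real) auto
    moreover have "of_real r powr of_real a = complex_of_real (r powr a)"
      using r by (intro powr_of_real) auto
    ultimately show ?thesis
      using stieltjes_powr_integral_real[OF a r] by simp
  qed
  have "?H w - ?R w = 0"
  proof (rule analytic_continuation[of "\<lambda>z. ?H z - ?R z" U "of_real ` {0<..<1}" "of_real (1/2)"])
    show "(\<lambda>z. ?H z - ?R z) holomorphic_on U" by (intro holomorphic_on_diff H R)
    show "complex_of_real (1/2) islimpt of_real ` {0<..<1}"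
      unfolding islimpt_approachable
    proof (intro allI impI)
      fix e :: real assume "e > 0"
      define d where "d = min (e/2) (1/4)"
      have "d > 0" "d < e" "d < 1/2" using \<open>e > 0\<close> by (auto simp: d_def)
      hence "dist (complex_of_real (1/2 + d)) (of_real (1/2)) < e" "1/2 + d \<in> {0<..<1}"
        by (auto simp: dist_norm simp flip: of_real_diff)
      thus "\<exists>x'\<in>complex_of_real ` {0<..<1}. x' \<noteq> of_real (1/2) \<and> dist x' (of_real (1/2)) < e"
        using \<open>d > 0\<close> by (intro bexI[of _ "of_real (1/2 + d)"]) (auto simp: complex_eq_iff)
    qed
    show "complex_of_real (1/2) \<in> U" by (subst real_in_U) auto
    show "w \<in> U" using w by (simp add: U_def)
  qed (use \<open>open U\<close> \<open>convex U\<close> eq real_in_U in \<open>auto intro: convex_connected\<close>)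
  thus ?thesis by simp
qed

section \<open>The Poisson kernel of a half-plane\<close>

text \<open>
  Up to a factor \<open>\<pi>\<close> this is the Poisson kernel of the upper half-plane for the point
  \<open>- \<beta> cos \<theta> + i \<beta> sin \<theta>\<close>.
\<close>
definition poisson_kernel :: "real \<Rightarrow> real \<Rightarrow> real \<Rightarrow> real" where
  "poisson_kernel \<theta> \<beta> x = \<beta> * sin \<theta> / (x^2 + 2 * x * \<beta> * cos \<theta> + \<beta>^2)"

lemma poisson_denominator_pos:
  fixes \<theta> \<beta> x :: real
  assumes "0 < \<theta>" "\<theta> < pi" "\<beta> > 0"
  shows "x^2 + 2 * x * \<beta> * cos \<theta> + \<beta>^2 > 0"
proof -
  have "x^2 + 2 * x * \<beta> * cos \<theta> + \<beta>^2 = (x + \<beta> * cos \<theta>)^2 + (\<beta> * sin \<theta>)^2"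
    using sin_cos_squared_add[of \<theta>] by algebra
  moreover have "(\<beta> * sin \<theta>)^2 > 0" using assms sin_gt_zero[of \<theta>] by simp
  ultimately show ?thesis by (simp add: add_nonneg_pos)
qed

lemma poisson_kernel_bounds:
  fixes \<theta> \<beta> x :: real
  assumes "0 < \<theta>" "\<theta> < pi" "\<beta> > 0"
  shows "0 \<le> poisson_kernel \<theta> \<beta> x" "poisson_kernel \<theta> \<beta> x \<le> 1 / (\<beta> * sin \<theta>)"
proof -
  have s: "sin \<theta> > 0" using assms sin_gt_zero by blast
  have "x^2 + 2 * x * \<beta> * cos \<theta> + \<beta>^2 = (x + \<beta> * cos \<theta>)^2 + (\<beta> * sin \<theta>)^2"
    using sin_cos_squared_add[of \<theta>] by algebra
  hence "(\<beta> * sin \<theta>)^2 \<le> x^2 + 2 * x * \<beta> * cos \<theta> + \<beta>^2" by simp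
  hence "\<beta> * sin \<theta> / (x^2 + 2 * x * \<beta> * cos \<theta> + \<beta>^2) \<le> \<beta> * sin \<theta> / (\<beta> * sin \<theta>)^2"
    using assms s by (intro divide_left_mono mult_pos_pos poisson_denominator_pos) auto
  thus "poisson_kernel \<theta> \<beta> x \<le> 1 / (\<beta> * sin \<theta>)"
    using s assms by (simp add: poisson_kernel_def power2_eq_square)
  show "0 \<le> poisson_kernel \<theta> \<beta> x"
    unfolding poisson_kernel_def using s assms
    by (intro divide_nonneg_nonneg less_imp_le[OF poisson_denominator_pos]) auto
qed

lemma poisson_kernel_eq_Im:
  "poisson_kernel \<theta> \<beta> x = - Im (1 / (of_real x + of_real \<beta> * cis \<theta>))"
proof -
  have "(x + \<beta> * cos \<theta>)^2 + (\<beta> * sin \<theta>)^2 = x^2 + 2 * x * \<beta> * cos \<theta> + \<beta>^2"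
    using sin_cos_squared_add[of \<theta>] by algebra
  thus ?thesis by (simp add: poisson_kernel_def Im_divide)
qed

text \<open>
  Minus the imaginary part of the geometric expansion of \<open>1 / (x + \<beta> e\<^sup>i\<^sup>\<theta>)\<close> in powers of \<open>\<beta>/x\<close>. The term of
  index \<open>0\<close> is real and disappears.
\<close>
lemma poisson_kernel_expansion:
  fixes \<theta> \<beta> x :: real
  assumes \<beta>: "0 < \<beta>" and x: "\<beta> < x"
  shows "(\<lambda>m. (-1)^m * sin (real (Suc m) * \<theta>) * \<beta>^Suc m * x powr (- real (Suc m) - 1)) sums poisson_kernel \<theta> \<beta> x"
proof -
  define w where "w = of_real \<beta> * cis \<theta>"
  have x0: "x > 0" using assms by simp
  have "norm (- (w / of_real x)) < 1"
    using assms by (simp add: w_def norm_mult norm_divide)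
  hence "(\<lambda>m. (- (w / of_real x))^m) sums (1 / (1 - - (w / of_real x)))"
    by (rule geometric_sums)
  hence "(\<lambda>m. (- (w / of_real x))^m * (1 / of_real x)) sums (1 / (1 - - (w / of_real x)) * (1 / of_real x))"
    by (rule sums_mult2)
  also have "1 / (1 - - (w / of_real x)) * (1 / of_real x) = 1 / (of_real x + w)"
    using x0 by (simp add: field_simps)
  finally have "(\<lambda>m. Im ((- (w / of_real x))^m * (1 / of_real x))) sums Im (1 / (of_real x + w))"
    by (rule sums_Im)
  moreover have "Im ((- (w / of_real x))^m * (1 / of_real x)) =
      (-1)^m * sin (real m * \<theta>) * \<beta>^m * x powr (- real m - 1)" for m
  proof -
    have wm: "w^m = of_real (\<beta>^m) * cis (real m * \<theta>)"
      by (simp add: w_def power_mult_distrib Complex.DeMoivre)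
    have xp: "x powr (- real m - 1) = 1 / x^(m+1)"
    proof -
      have e: "- real m - 1 = - real (m+1)" by simp
      show ?thesis unfolding e powr_minus_divide powr_realpow[OF x0] ..
    qed
    have "(- (w / of_real x))^m * (1 / of_real x) = (-1)^m * (w^m / of_real (x^m)) * (1 / of_real x)"
      by (subst power_minus) (simp add: power_divide)
    also have "\<dots> = of_real ((-1)^m * \<beta>^m * (1 / x^(m+1))) * cis (real m * \<theta>)"
      unfolding wm by (simp add: mult_ac)
    also have "Im \<dots> = (-1)^m * \<beta>^m * (1 / x^(m+1)) * sin (real m * \<theta>)" by simp
    finally show ?thesis unfolding xp by (simp add: mult_ac)
  qed
  ultimately have *: "(\<lambda>m. (-1)^m * sin (real m * \<theta>) * \<beta>^m * x powr (- real m - 1)) sums Im (1 / (of_real x + w))"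
    by simp
  hence "(\<lambda>m. (-1)^Suc m * sin (real (Suc m) * \<theta>) * \<beta>^Suc m * x powr (- real (Suc m) - 1)) sums Im (1 / (of_real x + w))"
    by (subst sums_Suc_iff) simp
  from sums_minus[OF this] show ?thesis
    by (simp add: poisson_kernel_eq_Im w_def)
qed

text \<open>
  Minus the imaginary part of the Stieltjes transform at \<open>w = \<beta> e\<^sup>i\<^sup>\<theta>\<close>. The term of index \<open>0\<close> of the power
  series is real, which shifts the index by one.
\<close>
lemma poisson_powr_integral:
  fixes a \<theta> \<beta> :: real
  assumes a: "a > 0" "a \<notin> \<int>" and \<theta>: "0 < \<theta>" "\<theta> < pi" and \<beta>: "0 < \<beta>" "\<beta> < 1"
  shows "integral {0..1} (\<lambda>x. x powr a * poisson_kernel \<theta> \<beta> x) =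
           (\<Sum>m. (-1)^m * sin (real (Suc m) * \<theta>) * \<beta>^Suc m / (a - real (Suc m)))
           + pi * \<beta> powr a * sin (a * \<theta>) / sin (a * pi)"
proof -
  define w where "w = of_real \<beta> * cis \<theta>"
  have nw: "norm w < 1" using \<beta> by (simp add: w_def norm_mult)
  have "cis (-\<theta>/2) * w = of_real \<beta> * cis (\<theta>/2)"
    by (simp add: w_def cis_mult mult.left_commute)
  hence "Re (cis (-\<theta>/2) * w) = \<beta> * cos (\<theta>/2)" by simp
  also have "\<dots> > 0" using \<theta> \<beta> by (intro mult_pos_pos cos_gt_zero) auto
  finally have half: "Re (cis (-\<theta>/2) * w) > 0" .
  have nz: "of_real t + w \<noteq> 0" for t :: real
  proof
    assume "of_real t + w = 0"
    hence "Im (of_real t + w) = 0" by simp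
    thus False using \<beta> sin_gt_zero[OF \<theta>] by (simp add: w_def)
  qed
  let ?h = "\<lambda>t. of_real (t powr a) / (of_real t + w)"
  have "?h integrable_on {0..1}"
    using a nz by (intro integrable_continuous_interval continuous_on_divide continuous_on_of_real
        continuous_on_powr' continuous_intros) auto
  hence 1: "integral {0..1} (\<lambda>t. Im (?h t)) = Im (integral {0..1} ?h)"
    using integral_linear[of ?h "{0..1}" Im] bounded_linear_Im by (simp add: o_def)
  have Imh: "Im (?h t) = - (t powr a * poisson_kernel \<theta> \<beta> t)" for t
  proof -
    have "?h t = of_real (t powr a) * (1 / (of_real t + w))" by simp
    also have "Im \<dots> = t powr a * Im (1 / (of_real t + w))"
      by (simp only: times_complex.sel Re_complex_of_real Im_complex_of_real mult_zero_left add_0_right)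
    finally show ?thesis by (simp add: poisson_kernel_eq_Im w_def)
  qed
  have Lnw: "Ln w = of_real (ln \<beta>) + \<i> * of_real \<theta>"
    using \<theta> \<beta> by (intro Ln_unique) (simp_all add: w_def exp_add cis_conv_exp exp_of_real)
  have wa: "w powr of_real a = of_real (\<beta> powr a) * cis (a * \<theta>)"
  proof -
    have "w \<noteq> 0" using \<beta> by (simp add: w_def)
    hence "w powr of_real a = exp (of_real a * Ln w)" by (simp add: powr_def)
    also have "of_real a * Ln w = of_real (a * ln \<beta>) + \<i> * of_real (a * \<theta>)"
      by (simp add: Lnw algebra_simps)
    also have "exp \<dots> = of_real (\<beta> powr a) * cis (a * \<theta>)"
      using \<beta> by (simp add: exp_add cis_conv_exp powr_def exp_of_real del: of_real_mult)
    finally show ?thesis .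
  qed
  let ?u = "\<lambda>m. (-w)^m / of_real (a - real m)"
  have Imu: "Im (?u m) = - ((-1)^(m+1) * sin (real m * \<theta>) * \<beta>^m / (a - real m))" for m
  proof -
    have "w^m = of_real (\<beta>^m) * cis (real m * \<theta>)"
      by (simp add: w_def power_mult_distrib Complex.DeMoivre)
    hence "?u m = of_real ((-1)^m * \<beta>^m / (a - real m)) * cis (real m * \<theta>)"
      by (simp add: power_minus[of w])
    also have "Im \<dots> = (-1)^m * \<beta>^m / (a - real m) * sin (real m * \<theta>)" by simp
    finally have Imw: "Im (?u m) = (-1)^m * \<beta>^m / (a - real m) * sin (real m * \<theta>)" .
    show ?thesis unfolding Imw by simp
  qed
  have "summable ?u" using nw by (intro summable_power_over_shifted_index) simp
  hence su: "(\<lambda>m. Im (?u m)) sums Im (suminf ?u)" by (intro sums_Im summable_sums)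
  have "Im (?u 0) = 0" by (simp add: Imu)
  with su have "(\<lambda>m. Im (?u (Suc m))) sums Im (suminf ?u)" by (subst sums_Suc_iff) simp
  from sums_minus[OF this]
  have "(\<lambda>m. (-1)^m * sin (real (Suc m) * \<theta>) * \<beta>^Suc m / (a - real (Suc m))) sums (- Im (suminf ?u))"
    unfolding Imu by simp
  hence 2: "- Im (suminf ?u) = (\<Sum>m. (-1)^m * sin (real (Suc m) * \<theta>) * \<beta>^Suc m / (a - real (Suc m)))"
    by (simp add: sums_iff)
  have "integral {0..1} (\<lambda>x. x powr a * poisson_kernel \<theta> \<beta> x) = - Im (integral {0..1} ?h)"
    unfolding 1[symmetric] Imh by (simp add: integral_neg)
  also have "\<dots> = - Im (suminf ?u) + Im (of_real (pi / sin (pi * a)) * w powr of_real a)"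
    unfolding stieltjes_powr_integral[OF a \<theta> nw half] by simp
  also have "Im (of_real (pi / sin (pi * a)) * w powr of_real a) = pi * \<beta> powr a * sin (a * \<theta>) / sin (a * pi)"
    unfolding wa by (simp add: mult_ac)
  finally show ?thesis unfolding 2 .
qed

lemma powr_poisson_set_integral:
  fixes a \<theta> \<beta> :: real
  assumes a: "a > 0" and \<theta>: "0 < \<theta>" "\<theta> < pi" and \<beta>: "0 < \<beta>"
  defines "f \<equiv> \<lambda>x. x powr a * poisson_kernel \<theta> \<beta> x"
  shows "set_integrable lborel {0<..<1} f" "set_lebesgue_integral lborel {0<..<1} f = integral {0..1} f"
    and "integral {0..1} f \<le> 1 / (\<beta> * sin \<theta>) * (1 / (a + 1))"
proof -
  have nz: "x^2 + 2 * x * \<beta> * cos \<theta> + \<beta>^2 \<noteq> 0" for x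
    using poisson_denominator_pos[OF \<theta> \<beta>, of x] by simp
  have cont: "continuous_on {0..1} f"
    unfolding f_def poisson_kernel_def using a nz
    by (intro continuous_on_mult continuous_on_divide continuous_on_powr' continuous_intros) auto
  have i: "set_integrable lborel {0..1} f" by (rule borel_integrable_atLeastAtMost'[OF cont])
  thus j: "set_integrable lborel {0<..<1} f" by (rule set_integrable_subset) auto
  show "set_lebesgue_integral lborel {0<..<1} f = integral {0..1} f"
    using set_borel_integral_eq_integral(2)[OF j] integral_open_interval_real[of 0 1 f] by simp
  have "((\<lambda>x. 1 / (\<beta> * sin \<theta>) * x powr a) has_integral 1 / (\<beta> * sin \<theta>) * (1 powr (a+1) / (a+1))) {0..1}"
    using a by (intro has_integral_mult_right has_integral_powr_from_0) auto
  moreover have "(f has_integral integral {0..1} f) {0..1}"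
    using cont by (intro integrable_integral integrable_continuous_interval)
  moreover have "f x \<le> 1 / (\<beta> * sin \<theta>) * x powr a" for x
    unfolding f_def using mult_left_mono[OF poisson_kernel_bounds(2)[OF \<theta> \<beta>, of x], of "x powr a"]
    by (simp add: mult_ac)
  ultimately show "integral {0..1} f \<le> 1 / (\<beta> * sin \<theta>) * (1 / (a + 1))"
    using has_integral_le[of f "integral {0..1} f" "{0..1}" "\<lambda>x. 1 / (\<beta> * sin \<theta>) * x powr a"] by simp
qed

section \<open>The logarithm integrated against the kernel\<close>

lemma ln_add_one_expansion:
  fixes y :: real
  assumes "\<bar>y\<bar> < 1"
  shows "(\<lambda>k. (-1)^k / real (Suc k) * y^Suc k) sums ln (1 + y)"
    and "summable (\<lambda>k. \<bar>(-1)^k / real (Suc k) * y^Suc k\<bar>)"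
proof -
  have "(\<lambda>n. - ((-y)^n) / real n) sums ln (1 + y)" by (rule ln_series'[OF assms])
  hence "(\<lambda>n. - ((-y)^Suc n) / real (Suc n)) sums ln (1 + y)"
    by (subst sums_Suc_iff) simp
  moreover have "- ((-y)^Suc n) / real (Suc n) = (-1)^n / real (Suc n) * y^Suc n" for n
    by (subst power_minus) simp
  ultimately show "(\<lambda>k. (-1)^k / real (Suc k) * y^Suc k) sums ln (1 + y)" by (simp only:)
  have g: "summable (\<lambda>k. \<bar>y\<bar>^Suc k)"
    using assms by (subst summable_Suc_iff) (simp add: summable_geometric)
  show "summable (\<lambda>k. \<bar>(-1)^k / real (Suc k) * y^Suc k\<bar>)"
  proof (rule summable_comparison_test'[OF g])
    fix k :: nat
    have "\<bar>y\<bar>^Suc k / real (Suc k) \<le> \<bar>y\<bar>^Suc k / 1" by (intro divide_left_mono) auto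
    thus "norm \<bar>(-1)^k / real (Suc k) * y^Suc k\<bar> \<le> \<bar>y\<bar>^Suc k"
      by (simp add: abs_mult power_abs)
  qed
qed

text \<open>
  The fundamental theorem of calculus on an unbounded interval; the left end point is left out of
  the interval because the integral of the logarithm is split into open intervals.
\<close>
lemma set_integral_FTC_greaterThan:
  fixes f F :: "real \<Rightarrow> real"
  assumes f: "f \<in> borel_measurable borel"
    and F: "\<And>x. a \<le> x \<Longrightarrow> (F has_real_derivative f x) (at x)"
    and nonneg: "\<And>x. a \<le> x \<Longrightarrow> 0 \<le> f x" and lim: "(F \<longlongrightarrow> T) at_top"
  shows "set_integrable lborel {a<..} f" "set_lebesgue_integral lborel {a<..} f = T - F a"
proof -
  have T: "F a \<le> T"
  proof (rule tendsto_lowerbound[OF lim])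
    show "\<forall>\<^sub>F x in at_top. F a \<le> F x"
      using eventually_ge_at_top[of a]
    proof eventually_elim
      case (elim x)
      thus ?case
      proof (rule DERIV_nonneg_imp_nondecreasing)
        fix y assume "a \<le> y"
        thus "\<exists>d. (F has_real_derivative d) (at y) \<and> 0 \<le> d" using F nonneg by blast
      qed
    qed
  qed simp
  have "(\<integral>\<^sup>+x. ennreal (f x) * indicator {a<..} x \<partial>lborel) = (\<integral>\<^sup>+x. ennreal (f x) * indicator {a..} x \<partial>lborel)"
    using AE_lborel_singleton[of a] by (intro nn_integral_cong_AE) (auto simp: indicator_def elim!: eventually_mono)
  also have "\<dots> = T - F a"
    by (rule nn_integral_FTC_atLeast[OF f F nonneg lim])
  also have "(\<integral>\<^sup>+x. ennreal (f x) * indicator {a<..} x \<partial>lborel) = (\<integral>\<^sup>+x. ennreal (indicator {a<..} x * f x) \<partial>lborel)"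
    by (intro nn_integral_cong) (auto simp: indicator_def)
  finally have nn: "(\<integral>\<^sup>+x. ennreal (indicator {a<..} x * f x) \<partial>lborel) = ennreal (T - F a)" .
  have "has_bochner_integral lborel (\<lambda>x. indicator {a<..} x * f x) (T - F a)"
  proof (rule has_bochner_integral_nn_integral[OF _ _ _ nn])
    show "(\<lambda>x. indicator {a<..} x * f x) \<in> borel_measurable lborel" using f by measurable
    show "AE x in lborel. 0 \<le> indicator {a<..} x * f x" using nonneg by (intro AE_I2) (auto simp: indicator_def)
    show "0 \<le> T - F a" using T by simp
  qed
  thus "set_integrable lborel {a<..} f" "set_lebesgue_integral lborel {a<..} f = T - F a"
    by (auto simp: set_integrable_def set_lebesgue_integral_def has_bochner_integral_iff)
qed

lemma set_integral_powr_above_one: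
  fixes s :: real
  assumes s: "s > 0"
  shows "set_integrable lborel {1<..} (\<lambda>x. x powr (-s-1))"
    and "set_lebesgue_integral lborel {1<..} (\<lambda>x. x powr (-s-1)) = 1 / s"
proof -
  have d: "((\<lambda>x. - (x powr (-s)) / s) has_real_derivative x powr (-s-1)) (at x)" if "1 \<le> x" for x
    using that s by (auto intro!: derivative_eq_intros simp: powr_diff)
  have l: "((\<lambda>x. - (x powr (-s)) / s) \<longlongrightarrow> 0) at_top" using s by real_asymp
  show "set_integrable lborel {1<..} (\<lambda>x. x powr (-s-1))"
    and "set_lebesgue_integral lborel {1<..} (\<lambda>x. x powr (-s-1)) = 1 / s"
    using set_integral_FTC_greaterThan[of "\<lambda>x. x powr (-s-1)", OF _ d _ l] by auto
qed

lemma set_integral_ln_powr_above_one: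
  fixes s :: real
  assumes s: "s > 0"
  shows "set_integrable lborel {1<..} (\<lambda>x. ln x * x powr (-s-1))"
    and "set_lebesgue_integral lborel {1<..} (\<lambda>x. ln x * x powr (-s-1)) = 1 / s^2"
proof -
  have d: "((\<lambda>x. - (ln x * x powr (-s)) / s - x powr (-s) / s^2) has_real_derivative ln x * x powr (-s-1)) (at x)"
    if "1 \<le> x" for x
  proof -
    have x: "x > 0" using that by simp
    have p: "((\<lambda>x. x powr (-s)) has_real_derivative (-s) * x powr (-s-1)) (at x)"
      using has_real_derivative_powr[OF x, of "-s"] by simp
    have xs: "inverse x * x powr (-s) = x powr (-s-1)"
      using x by (simp add: powr_diff inverse_eq_divide)
    show ?thesis
    proof (rule DERIV_cong[OF DERIV_diff[OF DERIV_cdivide[OF DERIV_minus[OF DERIV_mult[OF DERIV_ln[OF x] p]]] DERIV_cdivide[OF p]]])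
      show "- (inverse x * x powr (-s) + (-s) * x powr (-s-1) * ln x) / s - (-s) * x powr (-s-1) / s^2 = ln x * x powr (-s-1)"
        unfolding xs using s by (simp add: power2_eq_square add_divide_distrib diff_divide_distrib)
    qed
  qed
  have l: "((\<lambda>x. - (ln x * x powr (-s)) / s - x powr (-s) / s^2) \<longlongrightarrow> 0) at_top" using s by real_asymp
  show "set_integrable lborel {1<..} (\<lambda>x. ln x * x powr (-s-1))"
    and "set_lebesgue_integral lborel {1<..} (\<lambda>x. ln x * x powr (-s-1)) = 1 / s^2"
    using set_integral_FTC_greaterThan[of "\<lambda>x. ln x * x powr (-s-1)", OF _ d _ l] by auto
qed

text \<open>
  Here \<open>x > 1\<close>, and \<open>ln (1 + x\<^sup>\<alpha>) = \<alpha> ln x + ln (1 + x\<^bsup>-\<alpha>\<^esup>)\<close>. The first part gives \<open>\<alpha>/s\<^sup>2\<close>; the second is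
  expanded in powers of \<open>x\<^bsup>-\<alpha>\<^esup>\<close> and integrated term by term.
\<close>
lemma log_moment_above_one:
  fixes \<alpha> s :: real
  assumes \<alpha>: "\<alpha> > 0" and s: "s > 0"
  defines "f \<equiv> \<lambda>x. ln (1 + x powr \<alpha>) * x powr (-s-1)"
  shows "set_integrable lborel {1<..} f"
    and "summable (\<lambda>k. (-1)^k / (real (Suc k) * (\<alpha> * real (Suc k) + s)))"
    and "set_lebesgue_integral lborel {1<..} f =
           \<alpha> / s^2 + (\<Sum>k. (-1)^k / (real (Suc k) * (\<alpha> * real (Suc k) + s)))"
proof -
  let ?t = "\<lambda>k x. (-1)^k / real (Suc k) * x powr (- (\<alpha> * real (Suc k) + s) - 1)"
  let ?R = "\<lambda>x. ln (1 + x powr (-\<alpha>)) * x powr (-s-1)"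
  have pos: "\<alpha> * real (Suc k) + s > 0" for k using \<alpha> s by (intro add_nonneg_pos) auto
  have val: "set_lebesgue_integral lborel {1<..} (?t k) = (-1)^k / (real (Suc k) * (\<alpha> * real (Suc k) + s))" for k
    by (simp only: set_integral_mult_right set_integral_powr_above_one(2)[OF pos]) simp
  have t: "?t k x = (-1)^k / real (Suc k) * (x powr (-\<alpha>))^Suc k * x powr (-s-1)" if "x \<in> {1<..}" for k x
  proof -
    have "(x powr (-\<alpha>))^Suc k = x powr (-\<alpha> * real (Suc k))"
      using that by (subst powr_realpow[symmetric]) (auto simp: powr_powr)
    moreover have "x powr (- (\<alpha> * real (Suc k) + s) - 1) = x powr (-\<alpha> * real (Suc k)) * x powr (-s-1)"
    proof -
      have e: "- (\<alpha> * real (Suc k) + s) - 1 = -\<alpha> * real (Suc k) + (-s-1)" by simp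
      show ?thesis unfolding e by (rule powr_add)
    qed
    ultimately show ?thesis by (simp only: mult.assoc)
  qed
  have small: "\<bar>x powr (-\<alpha>)\<bar> < 1" if "x \<in> {1<..}" for x
    using that \<alpha> by (simp add: powr_less_one)
  have 1: "set_integrable lborel {1<..} (?t k)" for k
    using set_integral_powr_above_one(1)[OF pos] by (intro set_integrable_mult_right)
  have 2: "(\<lambda>k. ?t k x) sums ?R x" if "x \<in> {1<..}" for x
    unfolding t[OF that] by (intro sums_mult2 ln_add_one_expansion small that)
  have 3: "summable (\<lambda>k. \<bar>?t k x\<bar>)" if "x \<in> {1<..}" for x
    unfolding t[OF that] abs_mult[of _ "x powr (-s-1)"] by (intro summable_mult2 ln_add_one_expansion small that)
  have 4: "set_lebesgue_integral lborel {1<..} (\<lambda>x. \<bar>?t k x\<bar>) \<le> 1 / \<alpha> * (1 / real (Suc k)^2)" for k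
  proof -
    have "set_lebesgue_integral lborel {1<..} (\<lambda>x. \<bar>?t k x\<bar>) = 1 / real (Suc k) * (1 / (\<alpha> * real (Suc k) + s))"
    proof -
      have e: "\<bar>?t k x\<bar> = 1 / real (Suc k) * x powr (- (\<alpha> * real (Suc k) + s) - 1)" for x
        by (simp add: abs_mult)
      show ?thesis unfolding e set_integral_mult_right set_integral_powr_above_one(2)[OF pos] ..
    qed
    also have "\<dots> \<le> 1 / real (Suc k) * (1 / (\<alpha> * real (Suc k)))"
      using \<alpha> s by (intro mult_left_mono divide_left_mono mult_pos_pos pos) auto
    finally show ?thesis by (simp add: power2_eq_square mult_ac)
  qed
  have 5: "summable (\<lambda>k. 1 / \<alpha> * (1 / real (Suc k)^2))"
    by (intro summable_mult summable_inverse_square_Suc)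
  note R = set_integral_sums[of lborel "{1<..}" ?t ?R, OF 1 2 3 4 5]
  have split: "f x = \<alpha> * (ln x * x powr (-s-1)) + ?R x" if "x \<in> {1<..}" for x
  proof -
    have "1 + x powr \<alpha> = x powr \<alpha> * (1 + x powr (-\<alpha>))"
      using that by (simp add: distrib_left powr_minus)
    moreover have "0 < 1 + x powr (-\<alpha>)" "0 < x powr \<alpha>" using that by (auto simp: add_pos_nonneg)
    ultimately have "ln (1 + x powr \<alpha>) = ln (x powr \<alpha>) + ln (1 + x powr (-\<alpha>))"
      by (metis ln_mult_pos)
    thus ?thesis using that by (simp add: f_def ln_powr algebra_simps)
  qed
  have L: "set_integrable lborel {1<..} (\<lambda>x. \<alpha> * (ln x * x powr (-s-1)))"
    by (intro set_integrable_mult_right set_integral_ln_powr_above_one s)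
  have "set_integrable lborel {1<..} f \<longleftrightarrow> set_integrable lborel {1<..} (\<lambda>x. \<alpha> * (ln x * x powr (-s-1)) + ?R x)"
    using split by (intro set_integrable_cong) auto
  thus "set_integrable lborel {1<..} f" using set_integral_add(1)[OF L R(1)] by simp
  show "summable (\<lambda>k. (-1)^k / (real (Suc k) * (\<alpha> * real (Suc k) + s)))"
    using R(2) unfolding val by (rule sums_summable)
  have "set_lebesgue_integral lborel {1<..} f =
     set_lebesgue_integral lborel {1<..} (\<lambda>x. \<alpha> * (ln x * x powr (-s-1)) + ?R x)"
    using split by (intro set_lebesgue_integral_cong) auto
  also have "\<dots> = set_lebesgue_integral lborel {1<..} (\<lambda>x. \<alpha> * (ln x * x powr (-s-1)))
      + set_lebesgue_integral lborel {1<..} ?R"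
    by (rule set_integral_add(2)[OF L R(1)])
  also have "set_lebesgue_integral lborel {1<..} (\<lambda>x. \<alpha> * (ln x * x powr (-s-1))) = \<alpha> / s^2"
    using set_integral_ln_powr_above_one(2)[OF s] by simp
  also have "set_lebesgue_integral lborel {1<..} ?R = (\<Sum>k. (-1)^k / (real (Suc k) * (\<alpha> * real (Suc k) + s)))"
    using R(2) unfolding val by (simp add: sums_iff)
  finally show "set_lebesgue_integral lborel {1<..} f =
           \<alpha> / s^2 + (\<Sum>k. (-1)^k / (real (Suc k) * (\<alpha> * real (Suc k) + s)))" .
qed

text \<open>
  Expanding the logarithm; boundedness of the kernel makes the moments of order \<open>1/k\<close>, so the
  integrated series converges absolutely, although the logarithmic series does not at \<open>x = 1\<close>.
\<close>
lemma log_poisson_below_one: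
  fixes \<alpha> \<theta> \<beta> :: real
  assumes \<alpha>: "\<alpha> > 0" and \<theta>: "0 < \<theta>" "\<theta> < pi" and \<beta>: "0 < \<beta>"
  defines "f \<equiv> \<lambda>x. ln (1 + x powr \<alpha>) * poisson_kernel \<theta> \<beta> x"
  shows "set_integrable lborel {0<..<1} f"
    and "(\<lambda>k. (-1)^k / real (Suc k) * integral {0..1} (\<lambda>x. x powr (\<alpha> * real (Suc k)) * poisson_kernel \<theta> \<beta> x))
           sums set_lebesgue_integral lborel {0<..<1} f"
proof -
  let ?p = "\<lambda>k x. x powr (\<alpha> * real (Suc k)) * poisson_kernel \<theta> \<beta> x"
  let ?t = "\<lambda>k x. (-1)^k / real (Suc k) * ?p k x"
  let ?C = "1 / (\<beta> * sin \<theta>)"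
  have C: "?C > 0" using \<beta> sin_gt_zero[OF \<theta>] by simp
  have pos: "\<alpha> * real (Suc k) > 0" for k using \<alpha> by simp
  note P = powr_poisson_set_integral[OF pos \<theta> \<beta>]
  have t: "?t k x = (-1)^k / real (Suc k) * (x powr \<alpha>)^Suc k * poisson_kernel \<theta> \<beta> x" if "x \<in> {0<..<1}" for k x
  proof -
    have "(x powr \<alpha>)^Suc k = x powr (\<alpha> * real (Suc k))"
      using that by (subst powr_realpow[symmetric]) (auto simp: powr_powr)
    thus ?thesis by simp
  qed
  have small: "\<bar>x powr \<alpha>\<bar> < 1" if "x \<in> {0<..<1}" for x
    using that \<alpha> powr_less_mono2[of \<alpha> x 1] by simp
  have 1: "set_integrable lborel {0<..<1} (?t k)" for k by (intro set_integrable_mult_right P)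
  have 2: "(\<lambda>k. ?t k x) sums f x" if "x \<in> {0<..<1}" for x
    unfolding t[OF that] f_def by (intro sums_mult2 ln_add_one_expansion small that)
  have 3: "summable (\<lambda>k. \<bar>?t k x\<bar>)" if "x \<in> {0<..<1}" for x
    unfolding t[OF that] abs_mult[of _ "poisson_kernel \<theta> \<beta> x"]
    by (intro summable_mult2 ln_add_one_expansion small that)
  have 4: "set_lebesgue_integral lborel {0<..<1} (\<lambda>x. \<bar>?t k x\<bar>) \<le> ?C / \<alpha> * (1 / real (Suc k)^2)" for k
  proof -
    have e: "\<bar>?t k x\<bar> = 1 / real (Suc k) * ?p k x" for x
      using poisson_kernel_bounds(1)[OF \<theta> \<beta>, of x] by (simp add: abs_mult)
    have "set_lebesgue_integral lborel {0<..<1} (\<lambda>x. \<bar>?t k x\<bar>) = 1 / real (Suc k) * integral {0..1} (?p k)"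
      unfolding e set_integral_mult_right P(2) ..
    also have "\<dots> \<le> 1 / real (Suc k) * (?C * (1 / (\<alpha> * real (Suc k) + 1)))"
      by (intro mult_left_mono P) auto
    also have "\<dots> \<le> 1 / real (Suc k) * (?C * (1 / (\<alpha> * real (Suc k))))"
      using \<alpha> C by (intro mult_left_mono divide_left_mono mult_pos_pos add_nonneg_pos) auto
    finally show ?thesis by (simp add: power2_eq_square mult_ac)
  qed
  have 5: "summable (\<lambda>k. ?C / \<alpha> * (1 / real (Suc k)^2))"
    by (intro summable_mult summable_inverse_square_Suc)
  note R = set_integral_sums[of lborel "{0<..<1}" ?t f, OF 1 2 3 4 5]
  show "set_integrable lborel {0<..<1} f" by (rule R(1))
  show "(\<lambda>k. (-1)^k / real (Suc k) * integral {0..1} (?p k)) sums set_lebesgue_integral lborel {0<..<1} f"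
    using R(2) unfolding set_integral_mult_right P(2) .
qed

text \<open>
  Expanding the kernel. As \<open>x > 1\<close>, all terms are dominated by the first logarithmic moment times
  a geometric sequence of ratio \<open>\<beta>\<close>.
\<close>
lemma log_poisson_above_one:
  fixes \<alpha> \<theta> \<beta> :: real
  assumes \<alpha>: "\<alpha> > 0" and \<beta>: "0 < \<beta>" "\<beta> < 1"
  defines "f \<equiv> \<lambda>x. ln (1 + x powr \<alpha>) * poisson_kernel \<theta> \<beta> x"
  shows "set_integrable lborel {1<..} f"
    and "(\<lambda>m. (-1)^m * sin (real (Suc m) * \<theta>) * \<beta>^Suc m *
           set_lebesgue_integral lborel {1<..} (\<lambda>x. ln (1 + x powr \<alpha>) * x powr (- real (Suc m) - 1)))
           sums set_lebesgue_integral lborel {1<..} f"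
proof -
  let ?l = "\<lambda>m x. ln (1 + x powr \<alpha>) * x powr (- real (Suc m) - 1)"
  let ?s = "\<lambda>m. (-1)^m * sin (real (Suc m) * \<theta>) * \<beta>^Suc m"
  let ?t = "\<lambda>m x. ?s m * ?l m x"
  let ?B = "set_lebesgue_integral lborel {1<..} (?l 0)"
  have L: "set_integrable lborel {1<..} (?l m)" for m
    using log_moment_above_one(1)[OF \<alpha>, of "real (Suc m)"] by simp
  have l0: "0 \<le> ?l m x" for m x by (intro mult_nonneg_nonneg ln_ge_zero) auto
  have ll: "?l m x \<le> ?l 0 x" if "x \<in> {1<..}" for m x
    using that by (intro mult_left_mono powr_mono ln_ge_zero) auto
  have s: "\<bar>?s m\<bar> \<le> \<beta>^Suc m" for m
  proof -
    have "\<bar>?s m\<bar> = \<bar>sin (real (Suc m) * \<theta>)\<bar> * \<beta>^Suc m"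
      using \<beta> by (simp add: abs_mult)
    also have "\<dots> \<le> 1 * \<beta>^Suc m" using \<beta> by (intro mult_right_mono abs_sin_le_one) auto
    finally show ?thesis by simp
  qed
  have g: "summable (\<lambda>m. \<beta>^Suc m)"
    using \<beta> by (subst summable_Suc_iff) (simp add: summable_geometric)
  have bnd: "\<bar>?t m x\<bar> \<le> \<beta>^Suc m * ?l 0 x" if "x \<in> {1<..}" for m x
  proof -
    have "\<bar>?t m x\<bar> = \<bar>?s m\<bar> * ?l m x" using l0[of x m] by (simp only: abs_mult[of "?s m"] abs_of_nonneg)
    also have "\<dots> \<le> \<beta>^Suc m * ?l 0 x"
      using that \<beta> by (intro mult_mono s ll l0) auto
    finally show ?thesis .
  qed
  have 1: "set_integrable lborel {1<..} (?t m)" for m by (intro set_integrable_mult_right L)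
  have 2: "(\<lambda>m. ?t m x) sums f x" if "x \<in> {1<..}" for x
  proof -
    have "\<beta> < x" using that \<beta> by simp
    from sums_mult[OF poisson_kernel_expansion[OF \<beta>(1) this], of "ln (1 + x powr \<alpha>)"]
    show ?thesis unfolding f_def by (simp only: mult_ac)
  qed
  have 3: "summable (\<lambda>m. \<bar>?t m x\<bar>)" if "x \<in> {1<..}" for x
    by (rule summable_comparison_test'[OF summable_mult2[OF g]]) (use bnd[OF that] in auto)
  have 4: "set_lebesgue_integral lborel {1<..} (\<lambda>x. \<bar>?t m x\<bar>) \<le> \<beta>^Suc m * ?B" for m
  proof -
    have "set_lebesgue_integral lborel {1<..} (\<lambda>x. \<bar>?t m x\<bar>)
        \<le> set_lebesgue_integral lborel {1<..} (\<lambda>x. \<beta>^Suc m * ?l 0 x)"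
      by (intro set_integral_mono set_integrable_abs set_integrable_mult_right L 1 bnd)
    thus ?thesis unfolding set_integral_mult_right .
  qed
  have 5: "summable (\<lambda>m. \<beta>^Suc m * ?B)" by (intro summable_mult2 g)
  note R = set_integral_sums[of lborel "{1<..}" ?t f, OF 1 2 3 4 5]
  show "set_integrable lborel {1<..} f" by (rule R(1))
  show "(\<lambda>m. ?s m * set_lebesgue_integral lborel {1<..} (?l m)) sums set_lebesgue_integral lborel {1<..} f"
    using R(2) unfolding set_integral_mult_right .
qed

lemma log_poisson_integral_split:
  fixes \<alpha> \<theta> \<beta> :: real
  assumes \<alpha>: "\<alpha> > 0" and \<theta>: "0 < \<theta>" "\<theta> < pi" and \<beta>: "0 < \<beta>" "\<beta> < 1"
  defines "f \<equiv> \<lambda>x. ln (1 + x powr \<alpha>) * poisson_kernel \<theta> \<beta> x"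
  shows "set_lebesgue_integral lborel {0<..} f =
    set_lebesgue_integral lborel {0<..<1} f + set_lebesgue_integral lborel {1<..} f"
proof -
  have meas: "f \<in> borel_measurable borel" unfolding f_def poisson_kernel_def by measurable
  have "set_lebesgue_integral lborel {0<..} f = set_lebesgue_integral lborel ({0<..<1} \<union> {1<..}) f"
    using meas AE_lborel_singleton[of 1]
    by (intro set_integral_cong_set) (auto simp: set_borel_measurable_def elim!: eventually_mono)
  also have "\<dots> = set_lebesgue_integral lborel {0<..<1} f + set_lebesgue_integral lborel {1<..} f"
    unfolding f_def
    by (intro set_integral_Un log_poisson_below_one log_poisson_above_one assms) auto
  finally show ?thesis .
qed

section \<open>Small divisors\<close>

text \<open>
  For some \<open>n\<close> only finitely many fractions \<open>p/q\<close> are closer to \<open>x\<close> than \<open>1/q\<^sup>n\<close>. Those have a smallest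
  positive \<open>\<bar>xq - p\<bar>\<close>, and every other fraction satisfies the bound with constant \<open>1\<close>.
\<close>
lemma irrational_non_liouville_lower_bound:
  fixes x :: real
  assumes "x \<notin> \<rat>" "x \<notin> liouville_numbers"
  obtains c :: real and N :: nat where "c > 0"
    "\<And>(k::nat) (p::int). k \<ge> 1 \<Longrightarrow> c \<le> real k ^ N * \<bar>x * real k - of_int p\<bar>"
proof -
  obtain n :: nat where fin: "finite {(p::int, q::int). q \<ge> 1 \<and>
      0 < \<bar>x - of_int p / of_int q\<bar> \<and> \<bar>x - of_int p / of_int q\<bar> < 1 / of_int q ^ n}" (is "finite ?S")
    using assms(2) unfolding liouville_numbers_def by blast
  have nz: "x * of_int q - of_int p \<noteq> 0" if "q \<ge> 1" for p q :: int
  proof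
    assume "x * of_int q - of_int p = 0"
    hence "x = of_int p / of_int q" using that by (simp add: field_simps)
    thus False using assms(1) by (simp add: Rats_divide)
  qed
  define c where "c = Min (insert 1 ((\<lambda>(p, q). \<bar>x * of_int q - of_int p\<bar>) ` ?S))"
  have "c > 0"
    unfolding c_def using fin nz by (subst Min_gr_iff) auto
  moreover have "c \<le> real k ^ n * \<bar>x * real k - of_int p\<bar>" if k: "k \<ge> 1" for k p
  proof (cases "(p, int k) \<in> ?S")
    case True
    have "c \<le> \<bar>x * of_int (int k) - of_int p\<bar>"
      unfolding c_def using fin imageI[OF True, of "\<lambda>(p, q). \<bar>x * of_int q - of_int p\<bar>"]
      by (intro Min_le) simp_all
    also have "\<dots> \<le> real k ^ n * \<bar>x * real k - of_int p\<bar>"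
      using k by (simp add: mult_le_cancel_right1)
    finally show ?thesis .
  next
    case False
    have eq: "\<bar>x - of_int p / real k\<bar> = \<bar>x * real k - of_int p\<bar> / real k"
      using k by (simp add: field_simps abs_if)
    have "0 < \<bar>x - of_int p / real k\<bar>" using nz[of "int k" p] k eq by simp
    hence "\<not> \<bar>x - of_int p / real k\<bar> < 1 / real k ^ n" using False k by simp
    hence "1 / real k ^ n \<le> \<bar>x * real k - of_int p\<bar> / real k" using eq by simp
    also have "\<dots> \<le> \<bar>x * real k - of_int p\<bar>"
      using k by (simp add: field_simps mult_le_cancel_right1)
    finally have "1 \<le> real k ^ n * \<bar>x * real k - of_int p\<bar>"
      using k by (simp add: field_simps)
    moreover have "c \<le> 1" unfolding c_def using fin by (intro Min_le) auto
    ultimately show ?thesis by linarith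
  qed
  ultimately show ?thesis using that by blast
qed

text \<open>
  If \<open>m\<close> is less than half of \<open>\<alpha>k\<close>, the divisor \<open>\<alpha>k - m\<close> has the size of \<open>k\<close>. Otherwise \<open>k\<close> is at most
  a multiple of \<open>m\<close>, so the loss of a power of \<open>k\<close> in the Diophantine bound is only a loss of a power
  of \<open>m\<close>.
\<close>
lemma small_divisor_bound:
  fixes \<alpha> :: real
  assumes \<alpha>: "\<alpha> > 0" "\<alpha> \<notin> \<rat>" "\<alpha> \<notin> liouville_numbers"
  obtains D :: real and N :: nat where "D > 0"
    "\<And>k m. 1 / (real (Suc k) * \<bar>\<alpha> * real (Suc k) - real (Suc m)\<bar>) \<le> D * real (Suc m)^N / real (Suc k)^2"
proof -
  obtain c N where c: "c > 0" "\<And>(k::nat) (p::int). k \<ge> 1 \<Longrightarrow> c \<le> real k ^ N * \<bar>\<alpha> * real k - of_int p\<bar>"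
    using irrational_non_liouville_lower_bound[OF \<alpha>(2,3)] by blast
  \<comment> \<open>The two summands serve the two cases \<open>2m \<le> \<alpha>k\<close> and \<open>2m > \<alpha>k\<close>.\<close>
  define D where "D = 2 / \<alpha> + (2 / \<alpha>)^(N+1) / c"
  have D: "2 / \<alpha> \<le> D" "(2 / \<alpha>)^(N+1) / c \<le> D" "D > 0"
    using \<alpha> c by (auto simp: D_def add_pos_pos)
  have "1 / (real (Suc k) * \<bar>\<alpha> * real (Suc k) - real (Suc m)\<bar>) \<le> D * real (Suc m)^(N+1) / real (Suc k)^2" for k m
  proof -
    define x y d where "x = real (Suc k)" and "y = real (Suc m)" and "d = \<bar>\<alpha> * x - y\<bar>"
    have xy: "x \<ge> 1" "y \<ge> 1" by (auto simp: x_def y_def)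
    have cd: "c \<le> x^N * d" using c(2)[of "Suc k" "int (Suc m)"] by (simp add: x_def y_def d_def)
    have d: "d > 0"
    proof (rule ccontr)
      assume "\<not> d > 0"
      hence "d = 0" by (simp add: d_def)
      thus False using cd c(1) by simp
    qed
    have "x \<le> D * y^(N+1) * d"
    proof (cases "2 * y \<le> \<alpha> * x")
      case True
      hence "\<alpha> * x / 2 \<le> d" unfolding d_def by linarith
      hence "x \<le> 2 / \<alpha> * 1 * d" using \<alpha> by (simp add: field_simps)
      also have "\<dots> \<le> D * y^(N+1) * d"
        using D d xy by (intro mult_right_mono mult_mono one_le_power) auto
      finally show ?thesis .
    next
      case False
      hence xle: "x \<le> 2 / \<alpha> * y" using \<alpha> by (simp add: field_simps)
      have "x * c \<le> x * (x^N * d)" using cd xy by (intro mult_left_mono) auto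
      hence "x \<le> x^(N+1) * d / c" using c by (simp add: field_simps)
      also have "\<dots> \<le> (2 / \<alpha> * y)^(N+1) * d / c"
        using xle xy d c by (intro divide_right_mono mult_right_mono power_mono) auto
      also have "\<dots> = (2 / \<alpha>)^(N+1) / c * y^(N+1) * d"
        unfolding power_mult_distrib by simp
      also have "\<dots> \<le> D * y^(N+1) * d"
        using D d xy by (intro mult_right_mono) auto
      finally show ?thesis .
    qed
    hence "1 / (x * d) \<le> D * y^(N+1) / x^2"
      using xy d by (simp add: field_simps power2_eq_square)
    thus ?thesis by (simp add: x_def y_def d_def)
  qed
  thus ?thesis using that D(3) by blast
qed

lemma summable_power_times_geometric:
  fixes \<beta> :: real
  assumes "0 < \<beta>" "\<beta> < 1"
  shows "summable (\<lambda>m. real (Suc m)^N * \<beta>^Suc m)"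
proof (rule summable_comparison_test_ev)
  \<comment> \<open>One half of the geometric decay absorbs the power, the other half is left for the majorant.\<close>
  define q where "q = sqrt \<beta>"
  have q: "0 < q" "q < 1" and \<beta>: "\<beta> = q * q" using assms by (auto simp: q_def)
  show "summable (\<lambda>m. q^m)" using q by (simp add: summable_geometric)
  have "(\<lambda>m. real (Suc m)^N * q^m) \<longlonglongrightarrow> 0" using q by real_asymp
  hence "\<forall>\<^sub>F m in sequentially. real (Suc m)^N * q^m < 1" by (rule order_tendstoD) simp
  thus "\<forall>\<^sub>F m in sequentially. norm (real (Suc m)^N * \<beta>^Suc m) \<le> q^m"
  proof eventually_elim
    case (elim m)
    have "real (Suc m)^N * \<beta>^Suc m = (real (Suc m)^N * q^m) * (q * q) * q^m"
      by (simp add: \<beta> power_mult_distrib)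
    also have "\<dots> \<le> 1 * (1 * 1) * q^m"
      using elim q by (intro mult_right_mono mult_mono) auto
    finally show ?case using assms by (simp del: power_Suc of_nat_Suc)
  qed
qed

section \<open>The series expansion\<close>

theorem theorem1:
  fixes \<alpha> \<rho> \<beta> :: real
  assumes "\<alpha> \<in> admissible_indices"
    and "\<rho> \<in> {1 - 1/\<alpha>..1/\<alpha>} \<inter> {0<..<1}"
    and "0 < \<beta>" and "\<beta> < 1"
  defines "a \<equiv> \<lambda>m::nat. (-1) ^ (m + 1) * \<beta> ^ m * sin (\<rho> * real m * pi) / (real m * sin (real m * pi / \<alpha>))"
    and "b \<equiv> \<lambda>k::nat. (-1) ^ (k + 1) * \<beta> powr (\<alpha> * real k) * sin (\<rho> * \<alpha> * real k * pi) / (real k * sin (\<alpha> * real k * pi))"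
  shows "summable (\<lambda>n. a (Suc n)) \<and> summable (\<lambda>n. b (Suc n)) \<and>
    g \<alpha> \<rho> \<beta> = (\<Sum>n. a (Suc n)) + (\<Sum>n. b (Suc n))"
proof -
  define \<theta> where "\<theta> = pi * \<rho>"
  have \<alpha>: "\<alpha> > 0" "\<alpha> \<notin> \<rat>" "\<alpha> \<notin> liouville_numbers"
    using assms(1) by (auto simp: admissible_indices_def)
  have \<theta>: "0 < \<theta>" "\<theta> < pi" using assms(2) by (auto simp: \<theta>_def)
  have \<beta>: "0 < \<beta>" "\<beta> < 1" by fact+
  have irr1: "\<alpha> * real (Suc k) \<notin> \<int>" for k
  proof
    assume "\<alpha> * real (Suc k) \<in> \<int>"
    hence "\<alpha> * real (Suc k) \<in> \<rat>" using Ints_subset_Rats by blast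
    hence "\<alpha> * real (Suc k) / real (Suc k) \<in> \<rat>" by (intro Rats_divide Rats_of_nat)
    thus False using \<alpha> by simp
  qed
  have irr2: "real (Suc m) / \<alpha> \<notin> \<int>" for m
  proof
    assume "real (Suc m) / \<alpha> \<in> \<int>"
    hence "real (Suc m) / \<alpha> \<in> \<rat>" using Ints_subset_Rats by blast
    hence "real (Suc m) / (real (Suc m) / \<alpha>) \<in> \<rat>" by (rule Rats_divide[OF Rats_of_nat])
    moreover have "real (Suc m) / (real (Suc m) / \<alpha>) = \<alpha>" by simp
    ultimately show False using \<alpha> by metis
  qed
  let ?f = "\<lambda>x. ln (1 + x powr \<alpha>) * poisson_kernel \<theta> \<beta> x"
  let ?J = "\<lambda>k. integral {0..1} (\<lambda>x. x powr (\<alpha> * real (Suc k)) * poisson_kernel \<theta> \<beta> x)"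
  let ?L = "\<lambda>m. set_lebesgue_integral lborel {1<..} (\<lambda>x. ln (1 + x powr \<alpha>) * x powr (- real (Suc m) - 1))"
  define s e where "s m = (-1)^m * sin (real (Suc m) * \<theta>) * \<beta>^Suc m"
    and "e k = (-1)^k / real (Suc k)" for m k :: nat
  define A where "A k m = e k * (s m / (\<alpha> * real (Suc k) - real (Suc m)))" for k m
  obtain D N where D: "D > 0"
    "\<And>k m. 1 / (real (Suc k) * \<bar>\<alpha> * real (Suc k) - real (Suc m)\<bar>) \<le> D * real (Suc m)^N / real (Suc k)^2"
    using small_divisor_bound[OF \<alpha>] by blast
  have Abound: "\<bar>A k m\<bar> \<le> 1 / real (Suc k)^2 * (D * (real (Suc m)^N * \<beta>^Suc m))" for k m
  proof -
    have "\<bar>A k m\<bar> = \<bar>sin (real (Suc m) * \<theta>)\<bar> * (\<beta>^Suc m * (1 / (real (Suc k) * \<bar>\<alpha> * real (Suc k) - real (Suc m)\<bar>)))"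
      using \<beta> unfolding A_def e_def s_def by (simp add: abs_mult)
    also have "\<dots> \<le> 1 * (\<beta>^Suc m * (D * real (Suc m)^N / real (Suc k)^2))"
      using \<beta> by (intro mult_mono abs_sin_le_one order_refl D(2)) auto
    finally show ?thesis by (simp add: mult_ac)
  qed
  note swap = dominated_double_series_swap[of A, OF Abound summable_inverse_square_Suc
      summable_mult[OF summable_power_times_geometric[OF \<beta>]]]
  \<comment> \<open>Each moment on \<open>(0,1)\<close> is a row of the double series plus a term of the series in \<open>\<beta> powr (\<alpha> k)\<close>.\<close>
  have bA: "e k * ?J k = (\<Sum>m. A k m) + pi * b (Suc k)" for k
  proof -
    have "\<alpha> * real (Suc k) > 0" using \<alpha> by simp
    from poisson_powr_integral[OF this irr1 \<theta> \<beta>]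
    have J: "?J k = (\<Sum>m. s m / (\<alpha> * real (Suc k) - real (Suc m))) +
       pi * \<beta> powr (\<alpha> * real (Suc k)) * sin (\<alpha> * real (Suc k) * \<theta>) / sin (\<alpha> * real (Suc k) * pi)"
      unfolding s_def .
    have "e k \<noteq> 0" by (simp add: e_def)
    hence "summable (\<lambda>m. s m / (\<alpha> * real (Suc k) - real (Suc m)))"
      using swap(1)[of k] unfolding A_def summable_cmult_iff by blast
    hence "e k * (\<Sum>m. s m / (\<alpha> * real (Suc k) - real (Suc m))) = (\<Sum>m. A k m)"
      unfolding A_def by (rule suminf_mult[symmetric])
    moreover have "e k * (pi * \<beta> powr (\<alpha> * real (Suc k)) * sin (\<alpha> * real (Suc k) * \<theta>) / sin (\<alpha> * real (Suc k) * pi))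
       = pi * b (Suc k)"
      unfolding b_def e_def \<theta>_def by (simp add: mult_ac)
    ultimately show ?thesis unfolding J distrib_left by simp
  qed
  have below: "(\<lambda>k. (\<Sum>m. A k m) + pi * b (Suc k)) sums set_lebesgue_integral lborel {0<..<1} ?f"
    using log_poisson_below_one(2)[OF \<alpha>(1) \<theta> \<beta>(1)] unfolding bA[symmetric] e_def .
  from sums_diff[OF this summable_sums[OF swap(3)]]
  have "(\<lambda>k. pi * b (Suc k)) sums (set_lebesgue_integral lborel {0<..<1} ?f - (\<Sum>k. \<Sum>m. A k m))"
    by simp
  from sums_mult[OF this, of "1 / pi"]
  have b: "(\<lambda>k. b (Suc k)) sums (1 / pi * (set_lebesgue_integral lborel {0<..<1} ?f - (\<Sum>k. \<Sum>m. A k m)))"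
    by simp

  \<comment> \<open>A column of the double series and the logarithmic moment on \<open>(1,\<infinity>)\<close> carry the denominators
    \<open>\<alpha>k - m\<close> and \<open>\<alpha>k + m\<close>; together they form a cosecant.\<close>
  have aA: "pi * a (Suc m) = (\<Sum>k. A k m) + s m * ?L m" for m
  proof -
    define n where "n = real (Suc m)"
    have n: "n > 0" by (simp add: n_def)
    have L: "?L m = \<alpha> / n^2 + (\<Sum>k. (-1)^k / (real (Suc k) * (\<alpha> * real (Suc k) + n)))"
      and sL: "summable (\<lambda>k. (-1)^k / (real (Suc k) * (\<alpha> * real (Suc k) + n)))"
      using log_moment_above_one(2,3)[OF \<alpha>(1) n] by (simp_all add: n_def)
    have "s m * (e k * (1 / (\<alpha> * real (Suc k) - n) + 1 / (\<alpha> * real (Suc k) + n)))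
      = A k m + s m * ((-1)^k / (real (Suc k) * (\<alpha> * real (Suc k) + n)))" for k
      unfolding A_def n_def e_def by (simp add: distrib_left)
    hence "(\<lambda>k. A k m + s m * ((-1)^k / (real (Suc k) * (\<alpha> * real (Suc k) + n))))
        sums (s m * (pi / (n * sin (n * pi / \<alpha>)) - \<alpha> / n^2))"
      using sums_mult[OF pi_csc_partial_fractions_scaled[OF \<alpha>(1) n irr2[of m, folded n_def]], of "s m"]
      unfolding e_def by simp
    moreover have "(\<lambda>k. A k m + s m * ((-1)^k / (real (Suc k) * (\<alpha> * real (Suc k) + n))))
        sums ((\<Sum>k. A k m) + s m * (\<Sum>k. (-1)^k / (real (Suc k) * (\<alpha> * real (Suc k) + n))))"
      by (intro sums_add sums_mult summable_sums swap(2) sL)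
    ultimately have "(\<Sum>k. A k m) + s m * (\<Sum>k. (-1)^k / (real (Suc k) * (\<alpha> * real (Suc k) + n)))
        = s m * (pi / (n * sin (n * pi / \<alpha>)) - \<alpha> / n^2)"
      by (rule sums_unique2[symmetric])
    hence "(\<Sum>k. A k m) + s m * ?L m = s m * (pi / (n * sin (n * pi / \<alpha>)))"
      unfolding L by (simp add: algebra_simps)
    also have "\<dots> = pi * a (Suc m)"
      unfolding a_def s_def \<theta>_def n_def by (simp add: mult_ac)
    finally show ?thesis ..
  qed
  have "(\<lambda>m. (\<Sum>k. A k m) + s m * ?L m) sums ((\<Sum>m. \<Sum>k. A k m) + set_lebesgue_integral lborel {1<..} ?f)"
    using log_poisson_above_one(2)[OF \<alpha>(1) \<beta>, of \<theta>] unfolding s_def[symmetric]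
    by (intro sums_add summable_sums swap(4))
  from sums_mult[OF this[folded aA], of "1 / pi"]
  have a: "(\<lambda>m. a (Suc m)) sums (1 / pi * ((\<Sum>m. \<Sum>k. A k m) + set_lebesgue_integral lborel {1<..} ?f))"
    by simp

  have "g \<alpha> \<rho> \<beta> = 1 / pi * set_lebesgue_integral lborel {0<..} ?f"
  proof -
    have f: "?f x = sin (pi * \<rho>) * (\<beta> * ln (1 + x powr \<alpha>) / (x^2 + 2 * x * \<beta> * cos (pi * \<rho>) + \<beta>^2))" for x
      by (simp add: poisson_kernel_def \<theta>_def mult_ac)
    show ?thesis unfolding g_def f set_integral_mult_right by simp
  qed
  also have "\<dots> = (\<Sum>n. a (Suc n)) + (\<Sum>n. b (Suc n))"
    unfolding log_poisson_integral_split[OF \<alpha>(1) \<theta> \<beta>] sums_unique[OF a, symmetric] sums_unique[OF b, symmetric] swap(5)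
    by (simp add: algebra_simps)
  finally show ?thesis using a b by (auto simp: sums_iff)
qed

end
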